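(* Let $\mathcal{F}=\{\widehat{F_1},\widehat{F_2}\}$ be a GS set of order $2$ such that no member of $\mathcal{F}$ has underlying graph $K_1$ or $K_2$. Then, up to exchanging the names of $\widehat{F_1}$ and $\widehat{F_2}$, the signed graph $\widehat{F_1}$ is switching equivalent to $(K_3,-)$ or to $(K_4,-)$, and the underlying graph of $\widehat{F_2}$ is a linear forest.
   Context: All graphs are finite and simple. A signed graph $\widehat{G}=(G,\sigma)$ is a graph $G$ (its underlying graph) with $\sigma:E(G)\to\{+,-\}$. Switching a vertex $v$ multiplies the sign of every edge incident to $v$ by $-$; two signed graphs on the same graph are switching equivalent if one is obtained from the other by switching some vertices (and we also identify isomorphic signed graphs). $(G,-)$ is the signed graph on $G$ with all edges negative. The sign of a cycle is the product of the signs of its edges. A set $X$ of vertices of $\widehat G$ is balanced if every cycle of $\widehat{G}[X]$ is positive. The balanced chromatic number $\chi_b(\widehat G)$ is the minimum number of balanced sets needed to cover $V(G)$. A signed graph $\widehat H$ is an induced subgraph of a signed graph $\widehat G$ if $\widehat H$ is isomorphic to a signed graph obtained from $\widehat G$ by deleting vertices and switching at vertices. For a set $\mathcal F$ of signed graphs, $\mathrm{Forb}_{ind}(\mathcal F)$ is the class of signed (simple) graphs having no induced subgraph (in this sense) in $\mathcal F$. A finite set $\mathcal F$ is a GS set if there is a constant $C$ with $\chi_b(\widehat G)\le C$ for all $\widehat G\in \mathrm{Forb}_{ind}(\mathcal F)$. A linear forest is a forest each of whose components is a path (possibly a single vertex). *)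

theory Defs
  imports Main "HOL-Library.FuncSet"
begin

record 'a ugraph =
  gverts :: "'a set"
  gedges :: "'a set set"

record 'a sgraph = "'a ugraph" +
  gsign :: "'a set \<Rightarrow> int"

text \<open>Graphs are nonempty: an induced subgraph without vertices would make
  \<open>Forb_ind\<close> empty.\<close>

definition simple_graph :: "('a, 'b) ugraph_scheme \<Rightarrow> bool" where
  "simple_graph G \<longleftrightarrow> finite (gverts G) \<and> gverts G \<noteq> {} \<and>
     gedges G \<subseteq> {{u, v} | u v. u \<in> gverts G \<and> v \<in> gverts G \<and> u \<noteq> v}"

text \<open>The signs are the integers 1 and -1; the sign function is \<open>undefined\<close> outside the
  edge set, so that equality of records is equality of signed graphs.\<close>

definition signed_graph :: "'a sgraph \<Rightarrow> bool" where
  "signed_graph G \<longleftrightarrow> simple_graph G \<and> gsign G \<in> gedges G \<rightarrow>\<^sub>E {1, -1}"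

definition graph_isomorphism ::
    "('a \<Rightarrow> 'b) \<Rightarrow> ('a, 'c) ugraph_scheme \<Rightarrow> ('b, 'd) ugraph_scheme \<Rightarrow> bool" where
  "graph_isomorphism f G H \<longleftrightarrow>
     bij_betw f (gverts G) (gverts H) \<and> gedges H = (\<lambda>e. f ` e) ` gedges G"

definition graph_isomorphic ::
    "('a, 'c) ugraph_scheme \<Rightarrow> ('b, 'd) ugraph_scheme \<Rightarrow> bool" where
  "graph_isomorphic G H \<longleftrightarrow> (\<exists>f. graph_isomorphism f G H)"

definition signed_isomorphic :: "'a sgraph \<Rightarrow> 'b sgraph \<Rightarrow> bool" where
  "signed_isomorphic G H \<longleftrightarrow>
     (\<exists>f. graph_isomorphism f G H \<and> (\<forall>e \<in> gedges G. gsign H (f ` e) = gsign G e))"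

definition switch_vertex :: "'a \<Rightarrow> 'a sgraph \<Rightarrow> 'a sgraph" where
  "switch_vertex v G =
     G\<lparr>gsign := (\<lambda>e \<in> gedges G. if v \<in> e then - gsign G e else gsign G e)\<rparr>"

text \<open>Switching equivalence, with isomorphic signed graphs identified.\<close>

definition switching_equivalent :: "'a sgraph \<Rightarrow> 'b sgraph \<Rightarrow> bool" where
  "switching_equivalent G H \<longleftrightarrow>
     (\<exists>vs. set vs \<subseteq> gverts G \<and> signed_isomorphic (fold switch_vertex vs G) H)"

definition induced_graph :: "('a, 'b) ugraph_scheme \<Rightarrow> 'a set \<Rightarrow> 'a ugraph" where
  "induced_graph G X = \<lparr>gverts = X, gedges = {e \<in> gedges G. e \<subseteq> X}\<rparr>"

definition induced_sgraph :: "'a sgraph \<Rightarrow> 'a set \<Rightarrow> 'a sgraph" where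
  "induced_sgraph G X =
     \<lparr>gverts = X, gedges = {e \<in> gedges G. e \<subseteq> X},
      gsign = restrict (gsign G) {e \<in> gedges G. e \<subseteq> X}\<rparr>"

definition induced_subgraph_of :: "'b sgraph \<Rightarrow> 'a sgraph \<Rightarrow> bool" where
  "induced_subgraph_of H G \<longleftrightarrow>
     (\<exists>X \<subseteq> gverts G. switching_equivalent (induced_sgraph G X) H)"

text \<open>The cycle through the distinct vertices \<open>v0, ..., vk\<close> is given by the list of these
  vertices; its last edge is \<open>{vk, v0}\<close>.\<close>

definition cycle_edges :: "'a list \<Rightarrow> 'a set list" where
  "cycle_edges vs = map2 (\<lambda>u v. {u, v}) vs (rotate1 vs)"

definition is_cycle :: "('a, 'b) ugraph_scheme \<Rightarrow> 'a list \<Rightarrow> bool" where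
  "is_cycle G vs \<longleftrightarrow> 3 \<le> length vs \<and> distinct vs \<and> set (cycle_edges vs) \<subseteq> gedges G"

definition cycle_sign :: "'a sgraph \<Rightarrow> 'a list \<Rightarrow> int" where
  "cycle_sign G vs = prod_list (map (gsign G) (cycle_edges vs))"

definition balanced_set :: "'a sgraph \<Rightarrow> 'a set \<Rightarrow> bool" where
  "balanced_set G X \<longleftrightarrow> X \<subseteq> gverts G \<and>
     (\<forall>vs. is_cycle (induced_sgraph G X) vs \<longrightarrow> cycle_sign (induced_sgraph G X) vs = 1)"

definition balanced_chromatic_number :: "'a sgraph \<Rightarrow> nat" where
  "balanced_chromatic_number G =
     (LEAST k. \<exists>\<A>. finite \<A> \<and> card \<A> = k \<and> (\<forall>X \<in> \<A>. balanced_set G X) \<and> \<Union>\<A> = gverts G)"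

text \<open>Every finite signed graph is isomorphic to one whose vertices are natural numbers, so
  it suffices to let the members of \<open>Forb_ind\<close> range over these.\<close>

definition Forb_ind :: "'a sgraph set \<Rightarrow> nat sgraph set" where
  "Forb_ind \<F> = {G. signed_graph G \<and> \<not> (\<exists>H \<in> \<F>. induced_subgraph_of H G)}"

definition GS_set :: "'a sgraph set \<Rightarrow> bool" where
  "GS_set \<F> \<longleftrightarrow> finite \<F> \<and> (\<forall>H \<in> \<F>. signed_graph H) \<and>
     (\<exists>C. \<forall>G \<in> Forb_ind \<F>. balanced_chromatic_number G \<le> C)"

definition complete_graph :: "nat \<Rightarrow> nat ugraph" where
  "complete_graph n = \<lparr>gverts = {..<n}, gedges = {{i, j} | i j. i < n \<and> j < n \<and> i \<noteq> j}\<rparr>"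

definition path_graph :: "nat \<Rightarrow> nat ugraph" where
  "path_graph n = \<lparr>gverts = {..<n}, gedges = {{i, Suc i} | i. Suc i < n}\<rparr>"

definition all_negative :: "'a ugraph \<Rightarrow> 'a sgraph" where
  "all_negative G = \<lparr>gverts = gverts G, gedges = gedges G, gsign = (\<lambda>e \<in> gedges G. -1)\<rparr>"

definition component_sets :: "('a, 'b) ugraph_scheme \<Rightarrow> 'a set set" where
  "component_sets G = {{u. (v, u) \<in> {(x, y). {x, y} \<in> gedges G}\<^sup>*} | v. v \<in> gverts G}"

definition is_forest :: "('a, 'b) ugraph_scheme \<Rightarrow> bool" where
  "is_forest G \<longleftrightarrow> simple_graph G \<and> \<not> (\<exists>vs. is_cycle G vs)"

definition linear_forest :: "('a, 'b) ugraph_scheme \<Rightarrow> bool" where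
  "linear_forest G \<longleftrightarrow> is_forest G \<and>
     (\<forall>C \<in> component_sets G. \<exists>n\<ge>1. graph_isomorphic (induced_graph G C) (path_graph n))"

end

theory Submission
  imports Defs Complex_Main "HOL-Library.Nat_Bijection"
begin

text \<open>
  If \<open>\<F>\<close> is a GS set, then every family of signed graphs whose balanced chromatic numbers are
  unbounded contains a graph with a member of \<open>\<F>\<close> as an induced subgraph. Four families,
  all of them far from the balanced graphs but locally simple in different ways, leave only the
  claimed pairs.

  \<^item> In \<open>(K\<^sub>n, -)\<close> every induced subgraph is switching equivalent to some \<open>(K\<^sub>m, -)\<close>. So this is
    what one of the two members, called \<open>A\<close>, looks like; \<open>m \<ge> 3\<close> because \<open>K\<^sub>1\<close> and \<open>K\<^sub>2\<close> are excluded.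
    The other member is called \<open>B\<close>.

  \<^item> Let \<open>\<Gamma>\<close> have girth larger than \<open>g\<close> and large chromatic number. Balanced sets of \<open>(\<Gamma>, -)\<close>
    induce bipartite graphs, so \<open>(\<Gamma>, -)\<close> has large balanced chromatic number. It has no triangle, hence
    no \<open>A\<close>, so it contains \<open>B\<close>; as \<open>g\<close> was arbitrary, \<open>B\<close> is a forest.

  \<^item> Let the edges of a triangle-free \<open>\<Gamma>\<close> be the negative edges of a signed complete graph. Its
    balanced chromatic number is large for the same reason. It does not contain the forest \<open>B\<close>, for
    \<open>B\<close> would be complete. So it contains \<open>A\<close>; a copy of \<open>(K\<^sub>m, -)\<close> splits into
    two cliques of \<open>\<Gamma>\<close>, each with at most two vertices, whence \<open>m \<le> 4\<close>.

  \<^item> In the line graph of an oriented triangle-free \<open>\<Gamma>\<close>, let two arcs that meet be joined by a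
    negative edge if one ends where the other begins. A cycle of \<open>\<Gamma>\<close> of length \<open>k\<close> becomes a cycle of
    sign \<open>(-1)\<^sup>k\<close>, so the balanced sets are the bipartite sets of edges of \<open>\<Gamma>\<close>, and
    covering all the edges takes at least \<open>log\<^sub>2 \<chi>(\<Gamma>)\<close> of them. All triangles are positive, which excludes
    \<open>A\<close>, and there is no induced claw. So \<open>B\<close> has no vertex of degree three; a forest of
    maximum degree two is a linear forest.

  Two tools serve all four families. By \<open>balanced_set_potential\<close>, which is Harary's theorem, a balanced
  set carries a potential with values \<open>\<plusminus>1\<close> that induces the signs of its edges; a cover by balanced sets
  thereby becomes a colouring. The graphs \<open>\<Gamma>\<close> come from \<open>large_girth_small_independence\<close>,
  Erdos's theorem in the form that bounds the independence number.
\<close>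

section \<open>Cycles, balanced sets and potentials\<close>

lemma sign_square: "t \<in> {1, -1::int} \<Longrightarrow> t * t = 1" by auto

lemma cycle_edges_eq: "vs \<noteq> [] \<Longrightarrow> cycle_edges vs = map2 (\<lambda>u v. {u, v}) vs (tl vs @ [hd vs])"
  by (simp add: cycle_edges_def rotate1_hd_tl)

lemma set_cycle_edges:
  "set (cycle_edges vs) = {{vs ! i, vs ! (Suc i mod length vs)} | i. i < length vs}"
proof -
  have "set (cycle_edges vs) = {{vs ! i, rotate1 vs ! i} | i. i < length vs}"
    by (auto simp: cycle_edges_def set_zip)
  also have "\<dots> = {{vs ! i, vs ! (Suc i mod length vs)} | i. i < length vs}"
    by (metis (no_types, opaque_lifting) nth_rotate1)
  finally show ?thesis .
qed

lemma Union_cycle_edges: "\<Union> (set (cycle_edges vs)) = set vs"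
proof (intro equalityI subsetI)
  fix x assume "x \<in> \<Union> (set (cycle_edges vs))"
  then obtain i where "i < length vs" "x = vs ! i \<or> x = vs ! (Suc i mod length vs)"
    unfolding set_cycle_edges by blast
  moreover from this have "Suc i mod length vs < length vs" by (intro mod_less_divisor) auto
  ultimately show "x \<in> set vs" using nth_mem[of _ vs] by blast
next
  fix x assume "x \<in> set vs"
  then show "x \<in> \<Union> (set (cycle_edges vs))"
    unfolding set_cycle_edges in_set_conv_nth by blast
qed

lemma is_cycle_induced_iff:
  "is_cycle (induced_sgraph G X) vs \<longleftrightarrow> is_cycle G vs \<and> set vs \<subseteq> X"
  using Union_cycle_edges[of vs] by (auto simp: is_cycle_def induced_sgraph_def)

lemma cycle_sign_induced:
  assumes "is_cycle (induced_sgraph G X) vs"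
  shows "cycle_sign (induced_sgraph G X) vs = cycle_sign G vs"
proof -
  have "map (gsign (induced_sgraph G X)) (cycle_edges vs) = map (gsign G) (cycle_edges vs)"
    using assms by (intro map_cong) (auto simp: is_cycle_def induced_sgraph_def)
  then show ?thesis by (simp only: cycle_sign_def)
qed

lemma balanced_set_iff:
  "balanced_set G X \<longleftrightarrow>
    X \<subseteq> gverts G \<and> (\<forall>vs. is_cycle G vs \<longrightarrow> set vs \<subseteq> X \<longrightarrow> cycle_sign G vs = 1)"
  unfolding balanced_set_def
  by (metis cycle_sign_induced is_cycle_induced_iff)

lemma closed_path_edges:
  assumes "ps \<noteq> []"
  shows "set (map2 (\<lambda>u v. {u, v}) ps (tl ps @ [w])) \<subseteq> E \<longleftrightarrow>
    successively (\<lambda>a b. {a, b} \<in> E) ps \<and> {last ps, w} \<in> E"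
  using assms by (induction ps rule: induct_list012) auto

lemma is_cycle_path:
  assumes "distinct ps" "3 \<le> length ps" "successively (\<lambda>a b. {a, b} \<in> gedges G) ps"
    "{last ps, hd ps} \<in> gedges G"
  shows "is_cycle G ps"
proof -
  have "ps \<noteq> []" using assms(2) by auto
  then show ?thesis using assms closed_path_edges[of ps "hd ps" "gedges G"]
    by (simp add: is_cycle_def cycle_edges_eq)
qed

lemma simple_path_exists:
  assumes "(u, w) \<in> {(a, b). a \<in> X \<and> b \<in> X \<and> {a, b} \<in> E}\<^sup>*" "u \<in> X"
  shows "\<exists>ps. ps \<noteq> [] \<and> distinct ps \<and> set ps \<subseteq> X \<and> successively (\<lambda>a b. {a, b} \<in> E) ps \<and>
    hd ps = u \<and> last ps = w"
  using assms
proof (induction rule: converse_rtrancl_induct)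
  case base
  then show ?case by (intro exI[of _ "[w]"]) auto
next
  case (step u u')
  then obtain ps where ps: "ps \<noteq> []" "distinct ps" "set ps \<subseteq> X"
    "successively (\<lambda>a b. {a, b} \<in> E) ps" "hd ps = u'" "last ps = w" by auto
  show ?case
  proof (cases "u \<in> set ps")
    case True
    then obtain as bs where "ps = as @ u # bs" by (auto simp: in_set_conv_decomp)
    then show ?thesis using ps by (intro exI[of _ "u # bs"]) (auto simp: successively_append_iff)
  next
    case False
    then show ?thesis using ps step by (intro exI[of _ "u # ps"]) (cases ps; auto)
  qed
qed

lemma path_sign:
  assumes "ps \<noteq> []" "successively (\<lambda>a b. {a, b} \<in> E) ps" "set ps \<subseteq> X"
    and "\<And>x. t x \<in> {1, -1::int}"
    and "\<And>a b. a \<in> X \<Longrightarrow> b \<in> X \<Longrightarrow> {a, b} \<in> E \<Longrightarrow> s {a, b} = t a * t b"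
  shows "prod_list (map s (map2 (\<lambda>u v. {u, v}) ps (tl ps @ [w]))) =
    t (hd ps) * t (last ps) * s {last ps, w}"
  using assms(1-3)
proof (induction ps rule: induct_list012)
  case (2 x)
  then show ?case using assms(4)[of x] by auto
next
  case (3 x y zs)
  have "t y * t y = 1" using assms(4) by (rule sign_square)
  moreover have "s {x, y} = t x * t y" using 3 assms(5) by auto
  ultimately show ?case using 3 by (simp add: algebra_simps)
qed simp

text \<open>Harary's theorem, by induction on the set: let \<open>v\<close> be added to \<open>X\<close>. Two neighbours of \<open>v\<close> in one component of
  \<open>X\<close> demand the same value of \<open>v\<close>, since a path between them closes up through \<open>v\<close> to a positive
  cycle. So the potential on each component can be multiplied by a constant such that the value 1 is
  right for \<open>v\<close>.\<close>

lemma balanced_set_potential: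
  assumes "signed_graph G" "finite X" "balanced_set G X"
  shows "\<exists>t. (\<forall>x. t x \<in> {1, -1::int}) \<and>
    (\<forall>a\<in>X. \<forall>b\<in>X. {a, b} \<in> gedges G \<longrightarrow> gsign G {a, b} = t a * t b)"
  using assms(2,3)
proof (induction X rule: finite_induct)
  case empty
  show ?case by (rule exI[of _ "\<lambda>_. 1"]) simp
next
  case (insert v X)
  let ?E = "gedges G" and ?s = "gsign G"
  let ?R = "{(a, b). a \<in> X \<and> b \<in> X \<and> {a, b} \<in> ?E}\<^sup>*"
  have "balanced_set G X" using insert.prems by (auto simp: balanced_set_iff)
  then obtain t where t: "\<And>x. t x \<in> {1, -1::int}"
    and ts: "\<And>a b. a \<in> X \<Longrightarrow> b \<in> X \<Longrightarrow> {a, b} \<in> ?E \<Longrightarrow> ?s {a, b} = t a * t b"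
    using insert.IH by blast
  have s: "?s e \<in> {1, -1}" if "e \<in> ?E" for e
    using assms(1) that by (auto simp: signed_graph_def PiE_def Pi_def)
  have loop: "{v, v} \<notin> ?E"
    using assms(1) by (auto simp: signed_graph_def simple_graph_def doubleton_eq_iff)
  have sym: "(b, a) \<in> ?R" if "(a, b) \<in> ?R" for a b
  proof -
    have "sym ?R" by (intro sym_rtrancl) (auto simp: sym_def insert_commute)
    then show ?thesis using that by (auto simp: sym_def)
  qed
  have agree: "t a * ?s {v, a} = t b * ?s {v, b}"
    if "a \<in> X" "{v, a} \<in> ?E" "{v, b} \<in> ?E" "(a, b) \<in> ?R" for a b
  proof (cases "a = b")
    case False
    from simple_path_exists[OF that(4,1)]
    obtain ps where ps: "ps \<noteq> []" "distinct ps" "set ps \<subseteq> X"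
      "successively (\<lambda>a b. {a, b} \<in> ?E) ps" "hd ps = a" "last ps = b" by blast
    have len: "2 \<le> length ps" using ps False by (cases ps; cases "tl ps") auto
    have "is_cycle G (v # ps)"
      using ps that len insert.hyps
      by (intro is_cycle_path) (auto simp: insert_commute successively_Cons)
    moreover have "cycle_edges (v # ps) = {v, a} # map2 (\<lambda>u v. {u, v}) ps (tl ps @ [v])"
      using ps(1,5) by (cases ps) (auto simp: cycle_edges_eq)
    then have "cycle_sign G (v # ps) = ?s {v, a} * (t a * t b * ?s {b, v})"
      using path_sign[of ps ?E X t ?s v, OF ps(1,4,3) t ts] unfolding ps(5,6) cycle_sign_def
      by simp
    moreover have "set (v # ps) \<subseteq> insert v X" using ps by auto
    ultimately have "?s {v, a} * (t a * t b * ?s {v, b}) = 1"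
      using insert.prems unfolding balanced_set_iff by (metis insert_commute)
    then show ?thesis using t[of a] t[of b] s[OF that(2)] s[OF that(3)] by auto
  qed simp
  \<comment> \<open>\<open>f x\<close> is the correction of the potential on the component of \<open>x\<close>, and 1 if \<open>v\<close> has no
    neighbour there.\<close>
  define P where "P x u \<longleftrightarrow> u \<in> X \<and> {v, u} \<in> ?E \<and> (u, x) \<in> ?R" for x u
  define f where "f x = (if \<exists>u. P x u then t (SOME u. P x u) * ?s {v, SOME u. P x u} else 1)" for x
  have f_val: "f x = t u * ?s {v, u}" if "P x u" for x u
  proof -
    have "P x (SOME u. P x u)" using that by (rule someI)
    with that have "t (SOME u. P x u) * ?s {v, SOME u. P x u} = t u * ?s {v, u}"
      by (intro agree) (auto simp: P_def intro: rtrancl_trans sym)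
    then show ?thesis using that by (auto simp: f_def)
  qed
  have f_sign: "f x \<in> {1, -1}" for x
  proof (cases "\<exists>u. P x u")
    case True
    then obtain u where u: "P x u" by blast
    then have "?s {v, u} \<in> {1, -1}" using s by (auto simp: P_def)
    then show ?thesis using f_val[OF u] t[of u] by auto
  qed (simp add: f_def)
  have f_adj: "f a = f b" if "a \<in> X" "b \<in> X" "{a, b} \<in> ?E" for a b
  proof -
    have "(a, b) \<in> ?R" using that by auto
    then have "P a = P b" unfolding P_def by (auto intro!: ext intro: rtrancl_trans sym)
    then show ?thesis by (simp add: f_def)
  qed
  define t' where "t' x = (if x = v then 1 else t x * f x)" for x
  have "t' x \<in> {1, -1}" for x using t[of x] f_sign[of x] by (auto simp: t'_def)
  moreover have edge_v: "?s {v, b} = t' v * t' b" if "b \<in> X" "{v, b} \<in> ?E" for b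
  proof -
    have "f b = t b * ?s {v, b}" using that by (intro f_val) (auto simp: P_def)
    then show ?thesis using that insert.hyps t[of b] by (auto simp: t'_def)
  qed
  moreover have "?s {a, b} = t' a * t' b" if "a \<in> insert v X" "b \<in> insert v X" "{a, b} \<in> ?E" for a b
  proof -
    consider "a = v" | "b = v" "a \<noteq> v" | "a \<noteq> v" "b \<noteq> v" by blast
    then show ?thesis
    proof cases
      case 1
      then show ?thesis using that edge_v loop by (cases "b = v") auto
    next
      case 2
      then show ?thesis using that edge_v[of a] by (auto simp: insert_commute)
    next
      case 3
      then show ?thesis using that f_adj[of a b] ts[of a b] f_sign[of b]
        by (auto simp: t'_def)
    qed
  qed
  ultimately show ?case by (intro exI[of _ t']) blast
qed

lemma balanced_cover:
  assumes "signed_graph G" "balanced_chromatic_number G \<le> C"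
  shows "\<exists>\<A>. finite \<A> \<and> card \<A> \<le> C \<and> \<Union> \<A> = gverts G \<and> (\<forall>X\<in>\<A>. balanced_set G X)"
proof -
  define Q where "Q k \<longleftrightarrow> (\<exists>\<A>. finite \<A> \<and> card \<A> = k \<and> (\<forall>X \<in> \<A>. balanced_set G X) \<and> \<Union>\<A> = gverts G)" for k
  have "balanced_set G {v}" if "v \<in> gverts G" for v
  proof -
    have "\<not> set vs \<subseteq> {v}" if "is_cycle G vs" for vs
    proof
      assume "set vs \<subseteq> {v}"
      then have "card (set vs) \<le> 1" using card_mono[of "{v}" "set vs"] by auto
      then show False using that by (auto simp: is_cycle_def distinct_card)
    qed
    then show ?thesis using that by (auto simp: balanced_set_iff)
  qed
  moreover have "finite (gverts G)" using assms by (auto simp: signed_graph_def simple_graph_def)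
  ultimately have "Q (card ((\<lambda>v. {v}) ` gverts G))"
    unfolding Q_def by (intro exI[of _ "(\<lambda>v. {v}) ` gverts G"]) auto
  then have "Q (LEAST k. Q k)" by (rule LeastI)
  moreover have "(LEAST k. Q k) = balanced_chromatic_number G"
    by (simp add: Q_def[abs_def] balanced_chromatic_number_def)
  ultimately show ?thesis using assms(2) unfolding Q_def by auto
qed

lemma balanced_cover_potentials:
  assumes "signed_graph G" "balanced_chromatic_number G \<le> C"
  obtains \<A> p t where "finite \<A>" "card \<A> \<le> C" "\<And>v. v \<in> gverts G \<Longrightarrow> p v \<in> \<A> \<and> v \<in> p v"
    "\<And>X x. t X x \<in> {1, -1::int}"
    "\<And>X a b. X \<in> \<A> \<Longrightarrow> a \<in> X \<Longrightarrow> b \<in> X \<Longrightarrow> {a, b} \<in> gedges G \<Longrightarrow> gsign G {a, b} = t X a * t X b"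
proof -
  obtain \<A> where A: "finite \<A>" "card \<A> \<le> C" "\<Union> \<A> = gverts G" "\<And>X. X \<in> \<A> \<Longrightarrow> balanced_set G X"
    using balanced_cover[OF assms] by blast
  have "\<exists>t. (\<forall>x. t x \<in> {1, -1::int}) \<and>
    (X \<in> \<A> \<longrightarrow> (\<forall>a\<in>X. \<forall>b\<in>X. {a, b} \<in> gedges G \<longrightarrow> gsign G {a, b} = t a * t b))" for X
  proof (cases "X \<in> \<A>")
    case True
    have "finite X"
    proof (rule finite_subset)
      show "X \<subseteq> gverts G" using A(3) True by auto
      show "finite (gverts G)" using assms by (auto simp: signed_graph_def simple_graph_def)
    qed
    then show ?thesis using balanced_set_potential[OF assms(1) _ A(4)[OF True]] True by simp
  qed (auto intro: exI[of _ "\<lambda>_. 1"])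
  then obtain t where "\<And>X. (\<forall>x. t X x \<in> {1, -1::int}) \<and>
    (X \<in> \<A> \<longrightarrow> (\<forall>a\<in>X. \<forall>b\<in>X. {a, b} \<in> gedges G \<longrightarrow> gsign G {a, b} = t X a * t X b))" by metis
  then have "\<And>X x. t X x \<in> {1, -1}" and
    "\<And>X a b. X \<in> \<A> \<Longrightarrow> a \<in> X \<Longrightarrow> b \<in> X \<Longrightarrow> {a, b} \<in> gedges G \<Longrightarrow> gsign G {a, b} = t X a * t X b"
    by blast+
  moreover have "\<forall>v\<in>gverts G. \<exists>X. X \<in> \<A> \<and> v \<in> X" using A(3) by blast
  from bchoice[OF this] obtain p where "\<And>v. v \<in> gverts G \<Longrightarrow> p v \<in> \<A> \<and> v \<in> p v" by blast
  ultimately show ?thesis by (intro that[OF A(1,2)])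
qed

section \<open>Graphs of large girth and small independence number\<close>

text \<open>A uniformly distributed \<open>w\<close> in \<open>{..<M} \<rightarrow>\<^sub>E V \<times> V\<close> is a random graph with \<open>M\<close> edges, chosen
  independently with repetition, with loops discarded. Probabilities are counted out: this model keeps
  all the outcomes equally likely although the graph is sparse.\<close>

definition pair_edges :: "nat \<Rightarrow> (nat \<Rightarrow> 'a \<times> 'a) \<Rightarrow> 'a set set" where
  "pair_edges M w = {{a, b} | a b i. i < M \<and> w i = (a, b) \<and> a \<noteq> b}"

definition independent_in :: "'a set set \<Rightarrow> 'a set \<Rightarrow> bool" where
  "independent_in E S \<longleftrightarrow> (\<forall>u\<in>S. \<forall>v\<in>S. {u, v} \<notin> E)"

lemma card_independent:
  assumes "finite V" "S \<subseteq> V"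
  shows "card {w \<in> {..<M} \<rightarrow>\<^sub>E V \<times> V. independent_in (pair_edges M w) S} \<le>
    (card V * card V - (card S * card S - card S)) ^ M"
proof -
  let ?T = "S \<times> S - (\<lambda>a. (a, a)) ` S"
  have finS: "finite S" using assms finite_subset by blast
  have "{w \<in> {..<M} \<rightarrow>\<^sub>E V \<times> V. independent_in (pair_edges M w) S} \<subseteq> {..<M} \<rightarrow>\<^sub>E (V \<times> V - ?T)"
  proof (intro subsetI PiE_I)
    fix w i assume w: "w \<in> {w \<in> {..<M} \<rightarrow>\<^sub>E V \<times> V. independent_in (pair_edges M w) S}" and i: "i \<in> {..<M}"
    obtain a b where ab: "w i = (a, b)" by (cases "w i")
    have "\<not> (a \<in> S \<and> b \<in> S \<and> a \<noteq> b)"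
    proof
      assume *: "a \<in> S \<and> b \<in> S \<and> a \<noteq> b"
      then have "{a, b} \<in> pair_edges M w" using ab i unfolding pair_edges_def by blast
      then show False using * w by (auto simp: independent_in_def)
    qed
    moreover have "w i \<in> V \<times> V" using w i by blast
    ultimately show "w i \<in> V \<times> V - ?T" using ab by auto
  qed (auto simp: PiE_def extensional_def)
  then have "card {w \<in> {..<M} \<rightarrow>\<^sub>E V \<times> V. independent_in (pair_edges M w) S} \<le>
    card ({..<M} \<rightarrow>\<^sub>E (V \<times> V - ?T))"
    using assms by (intro card_mono finite_PiE) auto
  also have "\<dots> = card (V \<times> V - ?T) ^ M" by (simp add: card_PiE)
  also have "card (V \<times> V - ?T) = card V * card V - card ?T"
    using assms finS by (subst card_Diff_subset) (auto simp: card_cartesian_product)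
  also have "card ?T = card S * card S - card S"
    using finS by (subst card_Diff_subset) (auto simp: card_cartesian_product card_image inj_on_def)
  finally show ?thesis .
qed

lemma card_agreeing_functions:
  assumes "finite I" "finite A" "J \<subseteq> I" "K \<subseteq> I \<rightarrow>\<^sub>E A"
    and "\<And>w w' j. w \<in> K \<Longrightarrow> w' \<in> K \<Longrightarrow> j \<in> J \<Longrightarrow> w j = w' j"
  shows "card K \<le> card A ^ (card I - card J)"
proof -
  let ?r = "\<lambda>w. restrict w (I - J)"
  have "inj_on ?r K"
  proof (rule inj_onI)
    fix w w' assume w: "w \<in> K" "w' \<in> K" "?r w = ?r w'"
    have "w i = w' i" if "i \<in> I" for i
    proof (cases "i \<in> J")
      case False
      then show ?thesis using fun_cong[OF w(3), of i] that by simp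
    qed (use assms(5) w in blast)
    then show "w = w'" using assms(4) w by (intro PiE_ext[of w I "\<lambda>_. A" w']) auto
  qed
  moreover have "?r ` K \<subseteq> (I - J) \<rightarrow>\<^sub>E A"
  proof (intro image_subsetI restrict_PiE_iff[THEN iffD2] ballI)
    fix w i assume "w \<in> K" "i \<in> I - J"
    then show "w i \<in> A" using assms(4) by (auto dest!: subsetD)
  qed
  ultimately have "card K \<le> card ((I - J) \<rightarrow>\<^sub>E A)"
    using assms by (intro card_inj_on_le[where f = ?r] finite_PiE) auto
  also have "\<dots> = card A ^ card (I - J)" using assms by (simp add: card_PiE)
  also have "card (I - J) = card I - card J" using assms by (intro card_Diff_subset) (auto intro: finite_subset)
  finally show ?thesis .
qed

lemma cycle_edge_inj:
  assumes "distinct vs" "3 \<le> length vs" "i < length vs" "j < length vs"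
    and "{vs ! i, vs ! (Suc i mod length vs)} = {vs ! j, vs ! (Suc j mod length vs)}"
  shows "i = j"
proof (rule ccontr)
  assume "i \<noteq> j"
  have lt: "Suc i mod length vs < length vs" "Suc j mod length vs < length vs"
    using assms by (auto intro: mod_less_divisor)
  from \<open>i \<noteq> j\<close> have "i = Suc j mod length vs" "j = Suc i mod length vs"
    using assms lt by (auto simp: doubleton_eq_iff nth_eq_iff_index_eq)
  moreover have "Suc m mod length vs = (if Suc m = length vs then 0 else Suc m)"
    if "m < length vs" for m using that by auto
  ultimately show False using assms(2-4) by (auto split: if_splits)
qed

text \<open>Choose for each edge of the cycle an index at which \<open>w\<close> produces it, and the orientation in which it
  does: there are \<open>2 * M\<close> choices per edge. As the edges of a cycle are different, so are the
  indices, and \<open>length vs\<close> of the \<open>M\<close> values of \<open>w\<close> are then determined.\<close>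

lemma card_containing_cycle:
  assumes "finite V" "distinct vs" "3 \<le> length vs"
  shows "card {w \<in> {..<M} \<rightarrow>\<^sub>E V \<times> V. set (cycle_edges vs) \<subseteq> pair_edges M w} \<le>
    (2 * M) ^ length vs * (card V * card V) ^ (M - length vs)"
proof -
  let ?l = "length vs" and ?Om = "{..<M} \<rightarrow>\<^sub>E V \<times> V"
  define P :: "(nat \<times> bool) list set"
    where "P = {p. set p \<subseteq> {..<M} \<times> UNIV \<and> length p = ?l}"
  \<comment> \<open>the functions that produce the edges of the cycle in the places and orientations listed by \<open>p\<close>\<close>
  define cyl where "cyl p = {w \<in> ?Om. distinct (map fst p) \<and> (\<forall>j<?l. w (fst (p ! j)) =
    (if snd (p ! j) then (vs ! j, vs ! (Suc j mod ?l)) else (vs ! (Suc j mod ?l), vs ! j)))}" for p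
  have finP: "finite P" unfolding P_def by (intro finite_lists_length_eq) auto
  have cardP: "card P = (2 * M) ^ ?l"
    unfolding P_def by (subst card_lists_length_eq) (auto simp: card_cartesian_product mult.commute)
  have cyl: "card (cyl p) \<le> (card V * card V) ^ (M - ?l)" if p: "p \<in> P" for p
  proof (cases "distinct (map fst p)")
    case True
    let ?J = "set (map fst p)"
    have "card ?J = ?l" using True p distinct_card[OF True] by (simp add: P_def)
    moreover have "card (cyl p) \<le> card (V \<times> V) ^ (card {..<M} - card ?J)"
    proof (rule card_agreeing_functions)
      show "?J \<subseteq> {..<M}" using p by (auto simp: P_def)
      fix w w' i assume w: "w \<in> cyl p" "w' \<in> cyl p" "i \<in> ?J"
      then obtain j where "j < ?l" "i = fst (p ! j)"
        using p by (auto simp: P_def in_set_conv_nth)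
      then show "w i = w' i" using w by (auto simp: cyl_def)
    qed (use assms in \<open>auto simp: cyl_def\<close>)
    ultimately show ?thesis by (simp add: card_cartesian_product)
  qed (simp add: cyl_def)
  have "{w \<in> ?Om. set (cycle_edges vs) \<subseteq> pair_edges M w} \<subseteq> (\<Union>p\<in>P. cyl p)"
  proof
    fix w assume w: "w \<in> {w \<in> ?Om. set (cycle_edges vs) \<subseteq> pair_edges M w}"
    have "\<exists>i b. i < M \<and> w i =
      (if b then (vs ! j, vs ! (Suc j mod ?l)) else (vs ! (Suc j mod ?l), vs ! j))" if "j < ?l" for j
    proof -
      have "{vs ! j, vs ! (Suc j mod ?l)} \<in> pair_edges M w"
        using w that unfolding set_cycle_edges by blast
      then obtain a b i where i: "i < M" "w i = (a, b)" "{vs ! j, vs ! (Suc j mod ?l)} = {a, b}"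
        unfolding pair_edges_def by blast
      then show ?thesis
        by (intro exI[of _ i] exI[of _ "a = vs ! j"]) (auto simp: doubleton_eq_iff)
    qed
    then obtain f h where fh: "\<And>j. j < ?l \<Longrightarrow> f j < M \<and> w (f j) =
      (if h j then (vs ! j, vs ! (Suc j mod ?l)) else (vs ! (Suc j mod ?l), vs ! j))" by metis
    have "inj_on f {..<?l}"
    proof (rule inj_onI)
      fix i j assume ij: "i \<in> {..<?l}" "j \<in> {..<?l}" "f i = f j"
      then have "{vs ! i, vs ! (Suc i mod ?l)} = {vs ! j, vs ! (Suc j mod ?l)}"
        using fh[of i] fh[of j] by (auto split: if_splits)
      then show "i = j" using cycle_edge_inj[OF assms(2,3)] ij by blast
    qed
    define p where "p = map (\<lambda>j. (f j, h j)) [0..<?l]"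
    have "p \<in> P" using fh by (auto simp: p_def P_def)
    moreover have "w \<in> cyl p"
      using w fh \<open>inj_on f {..<?l}\<close>
      by (auto simp: p_def cyl_def distinct_map comp_def lessThan_atLeast0)
    ultimately show "w \<in> (\<Union>p\<in>P. cyl p)" by blast
  qed
  moreover have "finite (cyl p)" for p
    by (rule finite_subset[of _ ?Om]) (use assms in \<open>auto simp: cyl_def intro!: finite_PiE\<close>)
  ultimately have "card {w \<in> ?Om. set (cycle_edges vs) \<subseteq> pair_edges M w} \<le> card (\<Union>p\<in>P. cyl p)"
    using finP by (intro card_mono) auto
  also have "\<dots> \<le> (\<Sum>p\<in>P. card (cyl p))" using finP by (rule card_UN_le)
  also have "\<dots> \<le> card P * (card V * card V) ^ (M - ?l)"
    using sum_bounded_above[of P "\<lambda>p. card (cyl p)"] cyl by simp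
  finally show ?thesis by (simp add: cardP)
qed

definition short_cycles :: "nat \<Rightarrow> 'a set \<Rightarrow> 'a set set \<Rightarrow> 'a list set" where
  "short_cycles g V E = {vs. set vs \<subseteq> V \<and> 3 \<le> length vs \<and> length vs \<le> g \<and> distinct vs \<and>
     set (cycle_edges vs) \<subseteq> E}"

lemma finite_short_cycles: "finite V \<Longrightarrow> finite (short_cycles g V E)"
  by (rule finite_subset[OF _ finite_lists_length_le[of V g]]) (auto simp: short_cycles_def)

text \<open>The expected number of short cycles is bounded independently of \<open>n\<close> when the number of edges is linear
  in \<open>n\<close>: there are at most \<open>n ^ l\<close> cycles of length \<open>l\<close>, and each occurs with probability at most
  \<open>(2 * d * n) ^ l / (n * n) ^ l\<close>.\<close>

lemma sum_short_cycles:
  fixes n d g :: nat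
  assumes "finite V" "card V = n" "M = d * n" "g \<le> M"
  shows "(\<Sum>w \<in> {..<M} \<rightarrow>\<^sub>E V \<times> V. card (short_cycles g V (pair_edges M w))) \<le>
    (\<Sum>l\<le>g. (2 * d) ^ l) * (n * n) ^ M"
proof -
  let ?Om = "{..<M} \<rightarrow>\<^sub>E V \<times> V"
  define L where "L l = {vs. set vs \<subseteq> V \<and> length vs = l}" for l
  define Z where "Z = {vs. set vs \<subseteq> V \<and> 3 \<le> length vs \<and> length vs \<le> g \<and> distinct vs}"
  define N where "N vs = card {w \<in> ?Om. set (cycle_edges vs) \<subseteq> pair_edges M w}" for vs
  have finO: "finite ?Om" using assms by (auto intro: finite_PiE)
  have finL: "finite (L l)" for l unfolding L_def using assms by (intro finite_lists_length_eq)
  have ZL: "Z \<subseteq> (\<Union>l\<le>g. L l)" by (auto simp: Z_def L_def)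
  then have finZ: "finite Z" by (rule finite_subset) (auto intro: finL)
  have short: "short_cycles g V E = {vs \<in> Z. set (cycle_edges vs) \<subseteq> E}" for E
    by (auto simp: short_cycles_def Z_def)
  have "(\<Sum>w\<in>?Om. card (short_cycles g V (pair_edges M w))) =
    (\<Sum>w\<in>?Om. \<Sum>vs\<in>Z. if set (cycle_edges vs) \<subseteq> pair_edges M w then 1 else 0)"
    unfolding short by (simp only: card_eq_sum sum.inter_filter[OF finZ])
  also have "\<dots> = (\<Sum>vs\<in>Z. N vs)"
    unfolding N_def by (subst sum.swap) (simp only: card_eq_sum sum.inter_filter[OF finO])
  also have "\<dots> \<le> (\<Sum>vs\<in>Z. (2 * M) ^ length vs * (n * n) ^ (M - length vs))"
    unfolding N_def using card_containing_cycle[OF assms(1), of _ M] assms(2)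
    by (intro sum_mono) (auto simp: Z_def)
  also have "\<dots> \<le> (\<Sum>vs\<in>(\<Union>l\<le>g. L l). (2 * M) ^ length vs * (n * n) ^ (M - length vs))"
    using ZL finL by (intro sum_mono2) auto
  also have "\<dots> = (\<Sum>l\<le>g. \<Sum>vs\<in>L l. (2 * M) ^ length vs * (n * n) ^ (M - length vs))"
    using finL by (intro sum.UNION_disjoint) (auto simp: L_def)
  also have "\<dots> = (\<Sum>l\<le>g. n ^ l * ((2 * M) ^ l * (n * n) ^ (M - l)))"
    using assms by (intro sum.cong) (auto simp: L_def card_lists_length_eq)
  also have "\<dots> = (\<Sum>l\<le>g. (2 * d) ^ l * (n * n) ^ M)"
  proof (intro sum.cong refl)
    fix l assume "l \<in> {..g}"
    then have "(n * n) ^ M = (n * n) ^ l * (n * n) ^ (M - l)"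
      using assms by (simp flip: power_add)
    then show "n ^ l * ((2 * M) ^ l * (n * n) ^ (M - l)) = (2 * d) ^ l * (n * n) ^ M"
      unfolding assms(3) by (simp add: power_mult_distrib algebra_simps)
  qed
  finally show ?thesis by (simp add: sum_distrib_right)
qed

text \<open>The left-hand side is twice the union bound, over the at most \<open>2 ^ n\<close> sets of size \<open>s\<close>, for the
  number of outcomes with an independent set of that size. A fraction of at least
  \<open>1 / (8 * k\<^sup>2)\<close> of all the pairs are two different elements of such a set, so with \<open>16 * k\<^sup>2 * n\<close>
  edges each set is independent with probability at most \<open>exp (- 2 * n) \<le> (1 / 4) ^ n\<close>.\<close>

lemma many_independent_bound:
  fixes k s :: nat
  assumes "1 \<le> k" "2 \<le> s" "n = 2 * k * s" "M = 16 * k^2 * n"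
  shows "2 * (2 ^ n * (n * n - (s * s - s)) ^ M) < (n * n) ^ M"
proof -
  define q where "q = 8 * k^2"
  have q: "q \<ge> 1" using assms by (simp add: q_def)
  have n: "n \<ge> 4" using assms mult_le_mono[of 1 k 2 s] by simp
  have ss: "s \<le> s * s" "s * s - s \<le> n * n"
  proof -
    show "s \<le> s * s" by simp
    have "s \<le> n" using assms(1,3) by simp
    then have "s * s \<le> n * n" by (intro mult_mono) auto
    then show "s * s - s \<le> n * n" by linarith
  qed
  have "real (n * n - (s * s - s)) = real n * real n - (real s * real s - real s)"
    using ss by (simp add: of_nat_diff)
  also have "\<dots> \<le> real n * real n * (1 - 1 / q)"
  proof -
    have "real n * real n / q = real s * real s / 2"
      using assms(1) unfolding assms(3) q_def by (simp add: power2_eq_square field_simps)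
    moreover have "2 * real s \<le> real s * real s" using assms(2) by (intro mult_right_mono) auto
    ultimately show ?thesis by (simp add: algebra_simps)
  qed
  finally have base: "real (n * n - (s * s - s)) \<le> real n * real n * (1 - 1 / q)" .
  have "(1 - 1 / real q) ^ M \<le> exp (- 1 / real q) ^ M"
    using q exp_ge_add_one_self[of "- 1 / real q"] by (intro power_mono) auto
  also have "\<dots> = exp (- 2 * real n)"
    using assms(1,4) by (simp add: q_def flip: exp_of_nat_mult)
  also have "\<dots> = (1 / exp 1 ^ 2) ^ n"
    by (simp add: exp_minus field_simps flip: exp_of_nat_mult power_mult)
  also have "\<dots> \<le> (1 / 4) ^ n"
  proof (intro power_mono)
    have "(2::real) ^ 2 \<le> exp 1 ^ 2" using exp_ge_add_one_self[of 1] by (intro power_mono) auto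
    then show "1 / exp 1 ^ 2 \<le> (1 / 4 :: real)" by (simp add: field_simps)
  qed auto
  finally have pow: "(1 - 1 / real q) ^ M \<le> (1 / 4) ^ n" .
  have "real (2 * (2 ^ n * (n * n - (s * s - s)) ^ M)) \<le>
      2 * (2 ^ n * (real n * real n * (1 - 1 / q)) ^ M)"
    using base by (simp add: power_mono)
  also have "\<dots> = 2 * 2 ^ n * (real n * real n) ^ M * (1 - 1 / q) ^ M"
    by (simp add: power_mult_distrib)
  also have "\<dots> \<le> 2 * 2 ^ n * (real n * real n) ^ M * (1 / 4) ^ n"
    using pow by (intro mult_left_mono) auto
  also have "\<dots> = (real n * real n) ^ M * (2 * (1 / 2) ^ n)"
  proof -
    have "(1 / 4 :: real) ^ n = (1 / 2) ^ n * (1 / 2) ^ n" by (simp flip: power_mult_distrib)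
    moreover have "(2 :: real) ^ n * (1 / 2) ^ n = 1" by (simp flip: power_mult_distrib)
    ultimately show ?thesis by (simp add: algebra_simps)
  qed
  also have "\<dots> < (real n * real n) ^ M * 1"
  proof (rule mult_strict_left_mono)
    have "(1 / 2 :: real) ^ n \<le> (1 / 2) ^ 4" using n by (intro power_decreasing) auto
    then show "2 * (1 / 2 :: real) ^ n < 1" by (simp add: power4_eq_xxxx)
  qed (use n in auto)
  also have "\<dots> = real ((n * n) ^ M)" by simp
  finally show ?thesis by (simp only: of_nat_less_iff)
qed

text \<open>Erdos's deletion argument. More than half of the outcomes have no independent set of size \<open>s\<close>, so one of
  these has at most twice the average number \<open>c\<close> of short cycles. Deleting a vertex of each leaves at
  least half of the \<open>2 * k * s\<close> vertices. The bound on independent sets says that the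
  chromatic number exceeds \<open>k\<close>, and also that the graph is nonempty.\<close>

theorem large_girth_small_independence:
  fixes k g :: nat
  assumes "1 \<le> k"
  shows "\<exists>\<Gamma> :: nat ugraph. simple_graph \<Gamma> \<and> (\<forall>vs. is_cycle \<Gamma> vs \<longrightarrow> g < length vs) \<and>
    (\<forall>W \<subseteq> gverts \<Gamma>. independent_in (gedges \<Gamma>) W \<longrightarrow> k * card W < card (gverts \<Gamma>))"
proof -
  define d where "d = 16 * k^2"
  define c where "c = (\<Sum>l\<le>g. (2 * d) ^ l)"
  \<comment> \<open>The summand \<open>2 * c\<close> pays for the deleted vertices, \<open>g\<close> ensures that there are at least
    \<open>g\<close> edges, and 2 gives \<open>s * s - s \<ge> s * s / 2\<close>.\<close>
  define s where "s = 2 + 2 * c + g"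
  define n where "n = 2 * k * s"
  define M where "M = d * n"
  define V where "V = {..<n}"
  define Om where "Om = {..<M} \<rightarrow>\<^sub>E V \<times> V"
  define bad where "bad = {w \<in> Om. \<exists>S\<subseteq>V. card S = s \<and> independent_in (pair_edges M w) S}"
  define cyc where "cyc w = short_cycles g V (pair_edges M w)" for w
  have V: "finite V" "card V = n" by (simp_all add: V_def)
  have finO: "finite Om" using V by (auto simp: Om_def intro: finite_PiE)
  have cardO: "card Om = (n * n) ^ M" using V by (simp add: Om_def card_PiE card_cartesian_product)
  have ks: "s \<le> k * s" "1 \<le> d" using assms by (auto simp: d_def)
  then have "g \<le> n" by (simp add: n_def s_def)
  also have "n \<le> M" using ks by (simp add: M_def)
  finally have "g \<le> M" .
  have "card bad \<le> card (\<Union>S\<in>{S \<in> Pow V. card S = s}. {w \<in> Om. independent_in (pair_edges M w) S})"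
    using V finO by (intro card_mono) (auto simp: bad_def)
  also have "\<dots> \<le> (\<Sum>S\<in>{S \<in> Pow V. card S = s}. card {w \<in> Om. independent_in (pair_edges M w) S})"
    using V by (intro card_UN_le) auto
  also have "\<dots> \<le> (\<Sum>S\<in>{S \<in> Pow V. card S = s}. (n * n - (s * s - s)) ^ M)"
  proof (rule sum_mono)
    fix S assume "S \<in> {S \<in> Pow V. card S = s}"
    then show "card {w \<in> Om. independent_in (pair_edges M w) S} \<le> (n * n - (s * s - s)) ^ M"
      using card_independent[of V S M] V unfolding Om_def by auto
  qed
  also have "\<dots> \<le> 2 ^ n * (n * n - (s * s - s)) ^ M"
  proof -
    have "card {S \<in> Pow V. card S = s} \<le> card (Pow V)" using V by (intro card_mono) auto
    then show ?thesis using V by (simp add: card_Pow)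
  qed
  finally have "2 * card bad < card Om"
    using many_independent_bound[OF assms, of s n M] unfolding cardO
    by (simp add: s_def n_def M_def d_def)
  moreover have "card (Om - bad) + card bad = card Om"
    using finO by (subst card_Diff_subset) (auto simp: bad_def intro!: le_add_diff_inverse2 card_mono)
  ultimately have half: "card Om < 2 * card (Om - bad)" by linarith
  have "\<exists>w \<in> Om - bad. card (cyc w) \<le> 2 * c"
  proof (rule ccontr)
    assume "\<not> ?thesis"
    then have "2 * c + 1 \<le> card (cyc w)" if "w \<in> Om - bad" for w using that by force
    then have "card (Om - bad) * (2 * c + 1) \<le> (\<Sum>w\<in>Om - bad. card (cyc w))"
      using sum_bounded_below[of "Om - bad" "2 * c + 1" "\<lambda>w. card (cyc w)"] by simp
    also have "\<dots> \<le> (\<Sum>w\<in>Om. card (cyc w))" using finO by (intro sum_mono2) auto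
    also have "\<dots> \<le> c * card Om"
      unfolding cyc_def Om_def using sum_short_cycles[OF V M_def \<open>g \<le> M\<close>] cardO
      by (simp add: c_def Om_def)
    finally have "(2 * c + 1) * (2 * card (Om - bad)) \<le> 2 * c * card Om"
      by (simp add: algebra_simps)
    moreover have "(2 * c + 1) * card Om < (2 * c + 1) * (2 * card (Om - bad))"
      using half by (intro mult_strict_left_mono) auto
    ultimately show False by (simp add: algebra_simps)
  qed
  then obtain w where w: "w \<in> Om" "w \<notin> bad" "card (cyc w) \<le> 2 * c" by blast
  define U where "U = V - hd ` cyc w"
  define \<Gamma> where "\<Gamma> = \<lparr>gverts = U, gedges = {e \<in> pair_edges M w. e \<subseteq> U}\<rparr>"
  have "card (hd ` cyc w) \<le> 2 * c"
    using w(3) card_image_le[of "cyc w" hd] finite_short_cycles[OF V(1)] unfolding cyc_def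
    by (meson le_trans)
  moreover have "n - card (hd ` cyc w) \<le> card U"
    unfolding U_def using V diff_card_le_card_Diff[of "hd ` cyc w" V]
      finite_short_cycles[OF V(1)] by (simp add: cyc_def)
  moreover have "2 * c \<le> k * s" using ks(1) unfolding s_def by linarith
  ultimately have cardU: "k * s \<le> card U" unfolding n_def by linarith
  moreover have "0 < k * s" using assms by (simp add: s_def)
  ultimately have "U \<noteq> {}" by auto
  then have "simple_graph \<Gamma>"
    using V(1) unfolding simple_graph_def \<Gamma>_def U_def pair_edges_def by auto
  moreover have "g < length vs" if "is_cycle \<Gamma> vs" for vs
  proof (rule ccontr)
    assume short: "\<not> g < length vs"
    have sub: "set (cycle_edges vs) \<subseteq> pair_edges M w" "set vs \<subseteq> U"
      using that Union_cycle_edges[of vs] by (auto simp: is_cycle_def \<Gamma>_def)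
    moreover have "U \<subseteq> V" by (auto simp: U_def)
    ultimately have "vs \<in> cyc w"
      using that short by (auto simp: cyc_def short_cycles_def is_cycle_def)
    moreover have "hd vs \<in> set vs" using that by (auto simp: is_cycle_def intro!: hd_in_set)
    ultimately show False using sub(2) by (auto simp: U_def)
  qed
  moreover have "k * card W < card U" if W: "W \<subseteq> U" "independent_in (gedges \<Gamma>) W" for W
  proof -
    have "card W < s"
    proof (rule ccontr)
      assume "\<not> ?thesis"
      then obtain S where S: "S \<subseteq> W" "card S = s"
        using obtain_subset_with_card_n[of s W] by (metis not_less)
      then have "independent_in (pair_edges M w) S"
        using W unfolding independent_in_def \<Gamma>_def by (simp add: subset_iff)
      moreover have "S \<subseteq> V" using S(1) W(1) by (auto simp: U_def)
      ultimately show False using w S by (auto simp: bad_def)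
    qed
    then have "k * card W < k * s" using assms by simp
    then show ?thesis using cardU by linarith
  qed
  ultimately show ?thesis by (intro exI[of _ \<Gamma>]) (simp add: \<Gamma>_def)
qed

section \<open>Switching and induced subgraphs\<close>

lemma switch_vertex_graph [simp]:
  "gverts (switch_vertex x G) = gverts G" "gedges (switch_vertex x G) = gedges G"
  by (simp_all add: switch_vertex_def)

lemma fold_switch_verts [simp]:
  "gverts (fold switch_vertex vs G) = gverts G" "gedges (fold switch_vertex vs G) = gedges G"
  by (induction vs arbitrary: G) auto

lemma simple_graph_edge:
  assumes "simple_graph G" "e \<in> gedges G"
  obtains u v where "e = {u, v}" "u \<in> gverts G" "v \<in> gverts G" "u \<noteq> v"
  using assms unfolding simple_graph_def by blast

lemma simple_graph_edgeD:
  assumes "simple_graph G" "{u, v} \<in> gedges G"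
  shows "u \<in> gverts G" "v \<in> gverts G" "u \<noteq> v"
  using simple_graph_edge[OF assms] by (auto simp: doubleton_eq_iff)

lemma switch_vertex_sign:
  assumes "simple_graph G" "{u, v} \<in> gedges G"
  shows "gsign (switch_vertex x G) {u, v} =
    (if u = x then - 1 else 1) * (if v = x then - 1 else 1) * gsign G {u, v}"
  using assms simple_graph_edgeD[OF assms] by (auto simp: switch_vertex_def)

lemma simple_graph_switch [simp]: "simple_graph (switch_vertex x G) \<longleftrightarrow> simple_graph G"
  by (simp add: simple_graph_def)

lemma fold_switch_sign:
  assumes "simple_graph G"
  shows "\<exists>t. (\<forall>x. t x \<in> {1, -1::int}) \<and> (\<forall>u v. {u, v} \<in> gedges G \<longrightarrow>
    gsign (fold switch_vertex vs G) {u, v} = t u * t v * gsign G {u, v})"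
  using assms
proof (induction vs arbitrary: G)
  case Nil
  show ?case by (rule exI[of _ "\<lambda>_. 1"]) simp
next
  case (Cons x vs)
  have "simple_graph (switch_vertex x G)" using Cons.prems by simp
  from Cons.IH[OF this] obtain t where t: "\<And>y. t y \<in> {1, -1::int}"
    "\<And>u v. {u, v} \<in> gedges G \<Longrightarrow> gsign (fold switch_vertex (x # vs) G) {u, v} =
      t u * t v * gsign (switch_vertex x G) {u, v}"
    by auto
  let ?t = "\<lambda>y. if y = x then - t y else t y"
  have "?t y \<in> {1, -1}" for y using t(1)[of y] by auto
  moreover have "gsign (fold switch_vertex (x # vs) G) {u, v} = ?t u * ?t v * gsign G {u, v}"
    if "{u, v} \<in> gedges G" for u v
    using t(2)[OF that] switch_vertex_sign[OF Cons.prems that, of x] by auto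
  ultimately show ?case by (intro exI[of _ ?t]) blast
qed

lemma fold_switch_distinct:
  assumes "simple_graph G" "distinct vs" "{u, v} \<in> gedges G"
  shows "gsign (fold switch_vertex vs G) {u, v} =
    (if u \<in> set vs then - 1 else 1) * (if v \<in> set vs then - 1 else 1) * gsign G {u, v}"
  using assms
proof (induction vs arbitrary: G)
  case (Cons x vs)
  have "simple_graph (switch_vertex x G)" "{u, v} \<in> gedges (switch_vertex x G)"
    using Cons.prems by auto
  from Cons.IH[OF this(1) _ this(2)] show ?case
    using Cons.prems switch_vertex_sign[OF Cons.prems(1,3), of x] by auto
qed simp

text \<open>The converse of \<open>fold_switch_sign\<close>: every change of signs by a potential \<open>t\<close> is effected by switching
  once at each vertex where \<open>t\<close> is -1.\<close>

lemma switching_equivalentI: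
  assumes "simple_graph G" "bij_betw f (gverts G) (gverts H)"
    and "gedges H = (\<lambda>e. f ` e) ` gedges G"
    and t: "\<And>x. t x \<in> {1, -1::int}"
    and sgn: "\<And>u v. {u, v} \<in> gedges G \<Longrightarrow> gsign H {f u, f v} = t u * t v * gsign G {u, v}"
  shows "switching_equivalent G H"
proof -
  have "finite {x \<in> gverts G. t x = -1}" using assms(1) by (simp add: simple_graph_def)
  then obtain vs where vs: "distinct vs" "set vs = {x \<in> gverts G. t x = -1}"
    using finite_distinct_list by blast
  have tval: "(if x \<in> set vs then - 1 else 1) = t x" if "x \<in> gverts G" for x
    using that t[of x] by (auto simp: vs)
  have "gsign H (f ` e) = gsign (fold switch_vertex vs G) e" if "e \<in> gedges G" for e
  proof -
    from simple_graph_edge[OF assms(1) that]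
    obtain u v where uv: "e = {u, v}" "u \<in> gverts G" "v \<in> gverts G" by metis
    then show ?thesis
      using that sgn[of u v] fold_switch_distinct[OF assms(1) vs(1), of u v] tval
      by (simp del: if_split)
  qed
  then show ?thesis
    unfolding switching_equivalent_def signed_isomorphic_def graph_isomorphism_def
    using assms(2,3) vs by (intro exI[of _ vs] conjI exI[of _ f]) auto
qed

text \<open>The map \<open>h\<close> places \<open>H\<close> in \<open>G\<close> as an induced subgraph, and \<open>t\<close> is -1 at the vertices to be
  switched. In this form an induced subgraph is handled without reference to lists of switchings.\<close>

definition embeds :: "('b \<Rightarrow> 'a) \<Rightarrow> ('b \<Rightarrow> int) \<Rightarrow> 'b sgraph \<Rightarrow> 'a sgraph \<Rightarrow> bool" where
  "embeds h t H G \<longleftrightarrow> inj_on h (gverts H) \<and> h ` gverts H \<subseteq> gverts G \<and> (\<forall>x. t x \<in> {1, -1}) \<and>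
     (\<forall>x \<in> gverts H. \<forall>y \<in> gverts H. {x, y} \<in> gedges H \<longleftrightarrow> {h x, h y} \<in> gedges G) \<and>
     (\<forall>x y. {x, y} \<in> gedges H \<longrightarrow> gsign H {x, y} = t x * t y * gsign G {h x, h y})"

lemma induced_subgraph_embeds:
  assumes "simple_graph G" "simple_graph H" "induced_subgraph_of H G"
  shows "\<exists>h t. embeds h t H G"
proof -
  obtain X vs f where X: "X \<subseteq> gverts G"
    and iso: "graph_isomorphism f (fold switch_vertex vs (induced_sgraph G X)) H"
    and sgn: "\<forall>e\<in>gedges (induced_sgraph G X).
      gsign H (f ` e) = gsign (fold switch_vertex vs (induced_sgraph G X)) e"
    using assms(3)
    unfolding induced_subgraph_of_def switching_equivalent_def signed_isomorphic_def by auto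
  let ?I = "induced_sgraph G X"
  have I: "gverts ?I = X" "gedges ?I = {e \<in> gedges G. e \<subseteq> X}"
    by (auto simp: induced_sgraph_def)
  have f: "bij_betw f X (gverts H)" and E: "gedges H = (\<lambda>e. f ` e) ` gedges ?I"
    using iso by (auto simp: graph_isomorphism_def I)
  have "X \<noteq> {}" using f assms(2) by (auto simp: simple_graph_def bij_betw_def)
  have "simple_graph ?I"
    unfolding simple_graph_def I
  proof (intro conjI)
    show "finite X" using X assms(1) finite_subset by (auto simp: simple_graph_def)
    show "{e \<in> gedges G. e \<subseteq> X} \<subseteq> {{u, v} |u v. u \<in> X \<and> v \<in> X \<and> u \<noteq> v}"
      using simple_graph_edge[OF assms(1)] by (smt (verit, best) insert_subset mem_Collect_eq subsetI)
  qed fact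
  from fold_switch_sign[OF this, of vs] obtain t where t: "\<And>x. t x \<in> {1, -1::int}"
    and tI: "\<And>u v. {u, v} \<in> gedges ?I \<Longrightarrow> gsign (fold switch_vertex vs ?I) {u, v} = t u * t v * gsign ?I {u, v}"
    by blast
  define h where "h = inv_into X f"
  have h: "h y \<in> X" "f (h y) = y" if "y \<in> gverts H" for y
    using that f by (auto simp: h_def bij_betw_def inv_into_into f_inv_into_f)
  have hf: "h (f x) = x" if "x \<in> X" for x
    using that f by (auto simp: h_def bij_betw_def)
  have edge: "{x, y} \<in> gedges H \<longleftrightarrow> {h x, h y} \<in> gedges ?I" if "x \<in> gverts H" "y \<in> gverts H" for x y
  proof
    assume "{x, y} \<in> gedges H"
    then obtain e where e: "e \<in> gedges ?I" "{x, y} = f ` e" using E by blast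
    have "h ` {x, y} = h ` f ` e" using e by simp
    also have "\<dots> = e"
    proof -
      have "e \<subseteq> X" using e(1) by (simp add: I)
      then show ?thesis using hf by (force simp: image_image)
    qed
    finally show "{h x, h y} \<in> gedges ?I" using e(1) by simp
  next
    assume "{h x, h y} \<in> gedges ?I"
    then have "f ` {h x, h y} \<in> gedges H" unfolding E by blast
    then show "{x, y} \<in> gedges H" using h that by simp
  qed
  have "embeds h (t \<circ> h) H G"
    unfolding embeds_def
  proof (intro conjI allI ballI impI)
    show "inj_on h (gverts H)" by (metis h(2) inj_onI)
    show "h ` gverts H \<subseteq> gverts G" using h X by blast
    fix x y
    show "(t \<circ> h) x \<in> {1, -1}" using t by simp
    show "{x, y} \<in> gedges H \<longleftrightarrow> {h x, h y} \<in> gedges G" if "x \<in> gverts H" "y \<in> gverts H"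
      using edge[OF that] h that by (simp add: I)
    assume xy: "{x, y} \<in> gedges H"
    then have v: "x \<in> gverts H" "y \<in> gverts H" using simple_graph_edgeD[OF assms(2)] by blast+
    then have eI: "{h x, h y} \<in> gedges ?I" using edge xy by blast
    then have "gsign H {x, y} = gsign (fold switch_vertex vs ?I) {h x, h y}"
      using sgn h v by (metis image_empty image_insert)
    also have "\<dots> = t (h x) * t (h y) * gsign G {h x, h y}"
      using tI[OF eI] eI by (simp add: induced_sgraph_def)
    finally show "gsign H {x, y} = (t \<circ> h) x * (t \<circ> h) y * gsign G {h x, h y}" by simp
  qed
  then show ?thesis by blast
qed

lemma embeds_cycle:
  assumes "embeds h t H G" "simple_graph H" "is_cycle H vs"
  shows "is_cycle G (map h vs)"
proof -
  have "\<Union> (gedges H) \<subseteq> gverts H" using assms(2) by (auto elim!: simple_graph_edge)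
  then have sub: "set vs \<subseteq> gverts H"
    unfolding Union_cycle_edges[of vs, symmetric] using assms(3) by (auto simp: is_cycle_def)
  have "set (cycle_edges (map h vs)) \<subseteq> gedges G"
  proof
    fix e assume "e \<in> set (cycle_edges (map h vs))"
    then obtain i where i: "i < length vs" "e = {map h vs ! i, map h vs ! (Suc i mod length vs)}"
      unfolding set_cycle_edges length_map by blast
    define j where "j = Suc i mod length vs"
    have "j < length vs" unfolding j_def using i by (intro mod_less_divisor) auto
    then have e: "e = {h (vs ! i), h (vs ! j)}" using i unfolding j_def[symmetric] by simp
    have edge: "{vs ! i, vs ! j} \<in> gedges H"
      using assms(3) i(1) unfolding is_cycle_def set_cycle_edges j_def by blast
    then have "vs ! i \<in> gverts H" "vs ! j \<in> gverts H" using simple_graph_edgeD[OF assms(2)] by blast+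
    then show "e \<in> gedges G" unfolding e using assms(1) edge unfolding embeds_def by blast
  qed
  moreover have "distinct (map h vs)"
    using assms sub by (auto simp: distinct_map is_cycle_def embeds_def intro: inj_on_subset)
  ultimately show ?thesis using assms(3) by (simp add: is_cycle_def)
qed

lemma triangle_cycle:
  assumes "simple_graph G" "{a, b} \<in> gedges G" "{b, c} \<in> gedges G" "{a, c} \<in> gedges G"
  shows "is_cycle G [a, b, c]"
  using assms(2-) simple_graph_edgeD(3)[OF assms(1)]
  by (intro is_cycle_path) (auto simp: insert_commute)

text \<open>The only way in which the hypothesis is used: a signed graph of large balanced chromatic number contains
  one of the two members.\<close>

lemma GS_set_embeds:
  assumes "GS_set {A, B}"
  shows "\<exists>C. \<forall>G :: nat sgraph. signed_graph G \<longrightarrow> balanced_chromatic_number G > C \<longrightarrow>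
    (\<exists>h t. embeds h t A G) \<or> (\<exists>h t. embeds h t B G)"
proof -
  obtain C where C: "\<forall>G \<in> Forb_ind {A, B}. balanced_chromatic_number G \<le> C"
    and AB: "simple_graph A" "simple_graph B"
    using assms by (auto simp: GS_set_def signed_graph_def)
  have "(\<exists>h t. embeds h t A G) \<or> (\<exists>h t. embeds h t B G)"
    if G: "signed_graph G" "balanced_chromatic_number G > C" for G :: "nat sgraph"
  proof -
    have "G \<notin> Forb_ind {A, B}" using C G by force
    then have "induced_subgraph_of A G \<or> induced_subgraph_of B G" using G by (simp add: Forb_ind_def)
    moreover have "simple_graph G" using G by (simp add: signed_graph_def)
    ultimately show ?thesis using induced_subgraph_embeds AB by blast
  qed
  then show ?thesis by blast
qed

section \<open>Signed graphs of large balanced chromatic number\<close>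

text \<open>For symmetric relations, \<open>adj\<close> gives the edges and \<open>neg\<close> says which of them are negative.\<close>

definition sgraph_of :: "'a set \<Rightarrow> ('a \<Rightarrow> 'a \<Rightarrow> bool) \<Rightarrow> ('a \<Rightarrow> 'a \<Rightarrow> bool) \<Rightarrow> 'a sgraph" where
  "sgraph_of V adj neg = (let E = {{u, v} | u v. u \<in> V \<and> v \<in> V \<and> u \<noteq> v \<and> adj u v} in
     \<lparr>gverts = V, gedges = E, gsign = (\<lambda>e \<in> E. if \<exists>u v. e = {u, v} \<and> neg u v then -1 else 1)\<rparr>)"

lemma gverts_sgraph_of [simp]: "gverts (sgraph_of V adj neg) = V"
  by (simp add: sgraph_of_def Let_def)

lemma gedges_sgraph_of:
  assumes "symp adj"
  shows "{u, v} \<in> gedges (sgraph_of V adj neg) \<longleftrightarrow> u \<in> V \<and> v \<in> V \<and> u \<noteq> v \<and> adj u v"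
  using sympD[OF assms] by (auto simp: sgraph_of_def Let_def doubleton_eq_iff)

lemma gsign_sgraph_of:
  assumes "symp adj" "symp neg" "{u, v} \<in> gedges (sgraph_of V adj neg)"
  shows "gsign (sgraph_of V adj neg) {u, v} = (if neg u v then -1 else 1)"
proof -
  have "(\<exists>a b. {u, v} = {a, b} \<and> neg a b) \<longleftrightarrow> neg u v"
    using sympD[OF assms(2)] by (auto simp: doubleton_eq_iff)
  then show ?thesis using assms(3) by (simp add: sgraph_of_def Let_def)
qed

lemma signed_graph_sgraph_of:
  "finite V \<Longrightarrow> V \<noteq> {} \<Longrightarrow> signed_graph (sgraph_of V adj neg)"
  by (auto simp: signed_graph_def simple_graph_def sgraph_of_def Let_def)

text \<open>The colours may be of any type: below they are pairs of a balanced set and a sign, or families of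
  signs.\<close>

lemma proper_colouring_card:
  assumes "simple_graph \<Gamma>"
    and ind: "\<And>W. W \<subseteq> gverts \<Gamma> \<Longrightarrow> independent_in (gedges \<Gamma>) W \<Longrightarrow> k * card W < card (gverts \<Gamma>)"
    and col: "\<And>u v. {u, v} \<in> gedges \<Gamma> \<Longrightarrow> c u \<noteq> c v"
    and K: "finite K" "c ` gverts \<Gamma> \<subseteq> K"
  shows "k < card K"
proof (rule ccontr)
  assume le: "\<not> k < card K"
  let ?V = "gverts \<Gamma>"
  define F where "F j = {v \<in> ?V. c v = j}" for j
  have fin: "finite ?V" "?V \<noteq> {}" using assms(1) by (auto simp: simple_graph_def)
  have F: "k * card (F j) < card ?V" for j
    by (intro ind) (auto simp: F_def independent_in_def dest: col)
  have "K \<noteq> {}" using fin K by auto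
  have "?V = (\<Union>j\<in>K. F j)" using K by (auto simp: F_def)
  then have "card ?V \<le> (\<Sum>j\<in>K. card (F j))" using card_UN_le[OF K(1), of F] by simp
  then have "k * card ?V \<le> (\<Sum>j\<in>K. k * card (F j))" by (simp flip: sum_distrib_left)
  also have "\<dots> < (\<Sum>j\<in>K. card ?V)" using K \<open>K \<noteq> {}\<close> F by (intro sum_strict_mono) auto
  also have "\<dots> \<le> k * card ?V" using le by simp
  finally show False by simp
qed

text \<open>Colour each vertex by a balanced set that contains it, from an optimal cover, together with the value of
  the potential of that set. A negative edge within a balanced set joins different values of
  the potential, so this colours \<open>\<Gamma>\<close> properly with \<open>2 * C\<close> colours. The all-negative graph on
  \<open>\<Gamma>\<close> and the signed complete graph with negative part \<open>\<Gamma>\<close> are both of this form.\<close>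

lemma chi_b_negative_part:
  assumes \<Gamma>: "simple_graph \<Gamma>"
    and ind: "\<And>W. W \<subseteq> gverts \<Gamma> \<Longrightarrow> independent_in (gedges \<Gamma>) W \<Longrightarrow> 2 * C * card W < card (gverts \<Gamma>)"
    and G: "signed_graph G" "gverts G = gverts \<Gamma>" "gedges \<Gamma> \<subseteq> gedges G"
    and neg: "\<And>e. e \<in> gedges \<Gamma> \<Longrightarrow> gsign G e = -1"
  shows "C < balanced_chromatic_number G"
proof (rule ccontr)
  assume "\<not> ?thesis"
  then have le: "balanced_chromatic_number G \<le> C" by simp
  from balanced_cover_potentials[OF G(1) le] obtain \<A> p t where
    A: "finite \<A>" "card \<A> \<le> C" and p: "\<And>v. v \<in> gverts G \<Longrightarrow> p v \<in> \<A> \<and> v \<in> p v" and t: "\<And>X x. t X x \<in> {1, -1::int}"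
    and ts: "\<And>X a b. X \<in> \<A> \<Longrightarrow> a \<in> X \<Longrightarrow> b \<in> X \<Longrightarrow> {a, b} \<in> gedges G \<Longrightarrow>
      gsign G {a, b} = t X a * t X b"
    by metis
  let ?c = "\<lambda>v. (p v, t (p v) v)"
  have "2 * C < card (\<A> \<times> {1, -1::int})"
  proof (rule proper_colouring_card[OF \<Gamma> ind])
    fix u v assume e: "{u, v} \<in> gedges \<Gamma>"
    note uv = simple_graph_edgeD[OF \<Gamma> e]
    show "?c u \<noteq> ?c v"
    proof
      assume eq: "?c u = ?c v"
      have "-1 = t (p v) u * t (p v) v"
        using ts[of "p v" u v] p[of u] p[of v] uv neg[OF e] e G(2,3) eq by auto
      then show False using eq t[of "p v" v] by auto
    qed
  qed (use A(1) p t G(2) in auto)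
  then show False using A(2) by (simp add: card_cartesian_product)
qed

lemma simple_graph_complete: "0 < n \<Longrightarrow> simple_graph (complete_graph n)"
  by (auto simp: simple_graph_def complete_graph_def)

lemma all_negative_simps [simp]:
  "gverts (all_negative G) = gverts G" "gedges (all_negative G) = gedges G"
  "e \<in> gedges G \<Longrightarrow> gsign (all_negative G) e = -1"
  by (simp_all add: all_negative_def)

lemma signed_graph_all_negative: "simple_graph G \<Longrightarrow> signed_graph (all_negative G)"
  by (auto simp: signed_graph_def simple_graph_def all_negative_def)

lemma complete_graph_edge_iff [simp]:
  "{i, j} \<in> gedges (complete_graph n) \<longleftrightarrow> i < n \<and> j < n \<and> i \<noteq> j"
  by (auto simp: complete_graph_def doubleton_eq_iff)

text \<open>The complete graph itself has small independent sets, of size at most 1.\<close>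

lemma chi_b_complete:
  assumes "2 * C < n"
  shows "C < balanced_chromatic_number (all_negative (complete_graph n))"
proof (rule chi_b_negative_part)
  show "simple_graph (complete_graph n)" using assms by (intro simple_graph_complete) auto
  then show "signed_graph (all_negative (complete_graph n))" by (rule signed_graph_all_negative)
  fix W assume W: "W \<subseteq> gverts (complete_graph n)" "independent_in (gedges (complete_graph n)) W"
  have verts: "gverts (complete_graph n) = {..<n}" by (simp add: complete_graph_def)
  have "x = y" if "x \<in> W" "y \<in> W" for x y
  proof -
    have "{x, y} \<notin> gedges (complete_graph n)" using W(2) that by (simp add: independent_in_def)
    then show ?thesis using W(1) that unfolding verts complete_graph_edge_iff by blast
  qed
  moreover have "finite W" using W(1) finite_subset unfolding verts by blast
  ultimately have "card W \<le> 1" by (simp add: card_le_Suc0_iff_eq)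
  then have "2 * C * card W \<le> 2 * C * 1" by (intro mult_left_mono) auto
  then show "2 * C * card W < card (gverts (complete_graph n))"
    using assms unfolding verts card_lessThan by linarith
qed auto

definition triangle_free :: "('a, 'b) ugraph_scheme \<Rightarrow> bool" where
  "triangle_free \<Gamma> \<longleftrightarrow> (\<forall>a b c. {a, b} \<in> gedges \<Gamma> \<longrightarrow> {b, c} \<in> gedges \<Gamma> \<longrightarrow> {a, c} \<notin> gedges \<Gamma>)"

lemma triangle_freeI:
  assumes "simple_graph \<Gamma>" "\<And>vs. is_cycle \<Gamma> vs \<Longrightarrow> 3 < length vs"
  shows "triangle_free \<Gamma>"
  using triangle_cycle[OF assms(1)] assms(2) unfolding triangle_free_def by force

definition signed_complete :: "'a ugraph \<Rightarrow> 'a sgraph" where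
  "signed_complete \<Gamma> = sgraph_of (gverts \<Gamma>) (\<lambda>_ _. True) (\<lambda>u v. {u, v} \<in> gedges \<Gamma>)"

lemma signed_complete_verts [simp]: "gverts (signed_complete \<Gamma>) = gverts \<Gamma>"
  by (simp add: signed_complete_def)

lemma signed_complete_edge_iff:
  "{u, v} \<in> gedges (signed_complete \<Gamma>) \<longleftrightarrow> u \<in> gverts \<Gamma> \<and> v \<in> gverts \<Gamma> \<and> u \<noteq> v"
  unfolding signed_complete_def by (subst gedges_sgraph_of) (auto simp: symp_def)

lemma signed_complete_sign:
  assumes "{u, v} \<in> gedges (signed_complete \<Gamma>)"
  shows "gsign (signed_complete \<Gamma>) {u, v} = (if {u, v} \<in> gedges \<Gamma> then -1 else 1)"
  using assms unfolding signed_complete_def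
  by (intro gsign_sgraph_of) (auto simp: symp_def insert_commute)

section \<open>The signed line graph\<close>

text \<open>The vertices of the line graph have to be natural numbers; so an edge, oriented from its smaller end to its
  larger end, is represented by the code of the pair of its ends.\<close>

definition src :: "nat \<Rightarrow> nat" where "src i = fst (prod_decode i)"
definition tgt :: "nat \<Rightarrow> nat" where "tgt i = snd (prod_decode i)"

definition arcs :: "nat ugraph \<Rightarrow> nat set" where
  "arcs \<Gamma> = {i. src i < tgt i \<and> {src i, tgt i} \<in> gedges \<Gamma>}"

definition touching :: "nat \<Rightarrow> nat \<Rightarrow> bool" where
  "touching i j \<longleftrightarrow> src i = src j \<or> tgt i = tgt j \<or> src i = tgt j \<or> tgt i = src j"

definition consecutive :: "nat \<Rightarrow> nat \<Rightarrow> bool" where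
  "consecutive i j \<longleftrightarrow> src i = tgt j \<or> tgt i = src j"

text \<open>Give the incidence of an arc with its source the sign 1 and the one with its target the sign -1. Then two arcs
  meeting at a vertex are joined by an edge whose sign is the product of the two incidence signs there.\<close>

definition line_sgraph :: "nat ugraph \<Rightarrow> nat sgraph" where
  "line_sgraph \<Gamma> = sgraph_of (arcs \<Gamma>) touching consecutive"

lemma arc_eqI: "src i = src j \<Longrightarrow> tgt i = tgt j \<Longrightarrow> i = j"
  unfolding src_def tgt_def by (metis prod.expand prod_decode_inverse)

lemma src_tgt_encode [simp]: "src (prod_encode (a, b)) = a" "tgt (prod_encode (a, b)) = b"
  by (simp_all add: src_def tgt_def)

lemma symp_touching: "symp touching" "symp consecutive"
  by (auto simp: symp_def touching_def consecutive_def)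

lemma line_sgraph_verts [simp]: "gverts (line_sgraph \<Gamma>) = arcs \<Gamma>"
  by (simp add: line_sgraph_def)

lemma line_sgraph_edge_iff:
  "{i, j} \<in> gedges (line_sgraph \<Gamma>) \<longleftrightarrow> i \<in> arcs \<Gamma> \<and> j \<in> arcs \<Gamma> \<and> i \<noteq> j \<and> touching i j"
  unfolding line_sgraph_def by (rule gedges_sgraph_of[OF symp_touching(1)])

lemma line_sgraph_sign:
  "{i, j} \<in> gedges (line_sgraph \<Gamma>) \<Longrightarrow>
    gsign (line_sgraph \<Gamma>) {i, j} = (if consecutive i j then -1 else 1)"
  unfolding line_sgraph_def by (rule gsign_sgraph_of[OF symp_touching])

lemma finite_arcs:
  assumes "simple_graph \<Gamma>"
  shows "finite (arcs \<Gamma>)"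
proof (rule finite_subset)
  show "arcs \<Gamma> \<subseteq> prod_encode ` (gverts \<Gamma> \<times> gverts \<Gamma>)"
  proof
    fix i assume "i \<in> arcs \<Gamma>"
    then have "src i \<in> gverts \<Gamma>" "tgt i \<in> gverts \<Gamma>"
      using simple_graph_edgeD[OF assms] unfolding arcs_def by blast+
    moreover have "i = prod_encode (src i, tgt i)" by (simp add: src_def tgt_def)
    ultimately show "i \<in> prod_encode ` (gverts \<Gamma> \<times> gverts \<Gamma>)" by blast
  qed
  show "finite (prod_encode ` (gverts \<Gamma> \<times> gverts \<Gamma>))" using assms by (simp add: simple_graph_def)
qed

lemma arc_exists:
  assumes "simple_graph \<Gamma>" "{u, v} \<in> gedges \<Gamma>"
  obtains i where "i \<in> arcs \<Gamma>" "src i = u \<and> tgt i = v \<or> src i = v \<and> tgt i = u"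
proof (cases "u < v")
  case True
  then show ?thesis using assms that[of "prod_encode (u, v)"] by (simp add: arcs_def)
next
  case False
  then have "v < u" using simple_graph_edgeD(3)[OF assms] by simp
  then show ?thesis using assms that[of "prod_encode (v, u)"] by (simp add: arcs_def insert_commute)
qed

text \<open>A potential on a balanced set \<open>X\<close> of arcs induces a colouring of the vertices of \<open>\<Gamma>\<close>: multiply the
  potential of an arc by the sign of its incidence with the vertex. By the choice of the signs this is the
  same for all arcs of \<open>X\<close> at the vertex, and the two ends of an arc get opposite values. So the
  colourings that come from a cover by at most \<open>C\<close> balanced sets combine to a proper colouring with at
  most \<open>2 ^ C\<close> colours.\<close>

lemma chi_b_line_sgraph:
  assumes \<Gamma>: "simple_graph \<Gamma>" "gedges \<Gamma> \<noteq> {}"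
    and ind: "\<And>W. W \<subseteq> gverts \<Gamma> \<Longrightarrow> independent_in (gedges \<Gamma>) W \<Longrightarrow> 2 ^ C * card W < card (gverts \<Gamma>)"
  shows "signed_graph (line_sgraph \<Gamma>)" "C < balanced_chromatic_number (line_sgraph \<Gamma>)"
proof -
  let ?L = "line_sgraph \<Gamma>"
  obtain e where e: "e \<in> gedges \<Gamma>" using \<Gamma>(2) by blast
  obtain u v where "{u, v} \<in> gedges \<Gamma>"
    using simple_graph_edge[OF \<Gamma>(1) e] e by metis
  from arc_exists[OF \<Gamma>(1) this] have "arcs \<Gamma> \<noteq> {}" by blast
  then show L: "signed_graph ?L"
    unfolding line_sgraph_def by (intro signed_graph_sgraph_of finite_arcs \<Gamma>)
  show "C < balanced_chromatic_number ?L"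
  proof (rule ccontr)
    assume "\<not> ?thesis"
    then have le: "balanced_chromatic_number ?L \<le> C" by simp
    from balanced_cover_potentials[OF L le] obtain \<A> p t where
      A: "finite \<A>" "card \<A> \<le> C" and p: "\<And>i. i \<in> arcs \<Gamma> \<Longrightarrow> p i \<in> \<A> \<and> i \<in> p i"
      and t: "\<And>X x. t X x \<in> {1, -1::int}"
      and ts: "\<And>X a b. X \<in> \<A> \<Longrightarrow> a \<in> X \<Longrightarrow> b \<in> X \<Longrightarrow> {a, b} \<in> gedges ?L \<Longrightarrow>
        gsign ?L {a, b} = t X a * t X b"
      by (metis line_sgraph_verts)
    \<comment> \<open>the arc \<open>i\<close> gives the vertex \<open>v\<close> the value 1; vertices not met by \<open>X\<close> get the value -1\<close>
    define Q where "Q X v i \<longleftrightarrow> i \<in> X \<and> i \<in> arcs \<Gamma> \<and> (src i = v \<and> t X i = 1 \<or> tgt i = v \<and> t X i = -1)"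
      for X v i
    define c where "c v = (\<lambda>X\<in>\<A>. if \<exists>i. Q X v i then 1 else (-1::int))" for v
    have c: "c (src i) X = t X i \<and> c (tgt i) X = - t X i" if "i \<in> X" "i \<in> arcs \<Gamma>" "X \<in> \<A>" for i X
    proof -
      have sgn: "(if consecutive i j then -1 else 1) = t X i * t X j"
        if "j \<in> X" "j \<in> arcs \<Gamma>" "i \<noteq> j" "touching i j" for j
        using ts[OF \<open>X \<in> \<A>\<close> \<open>i \<in> X\<close> that(1)] line_sgraph_sign[of i j \<Gamma>] that \<open>i \<in> arcs \<Gamma>\<close>
        by (simp add: line_sgraph_edge_iff)
      have Qs: "t X i = 1" if "Q X (src i) j" for j
        using that sgn[of j] t[of X i] \<open>i \<in> arcs \<Gamma>\<close>
        by (cases "i = j") (auto simp: Q_def consecutive_def touching_def arcs_def split: if_splits)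
      have Qt: "t X i = -1" if "Q X (tgt i) j" for j
        using that sgn[of j] t[of X i] \<open>i \<in> arcs \<Gamma>\<close>
        by (cases "i = j") (auto simp: Q_def consecutive_def touching_def arcs_def split: if_splits)
      have "Q X (src i) i" if "t X i = 1" using that \<open>i \<in> X\<close> \<open>i \<in> arcs \<Gamma>\<close> by (simp add: Q_def)
      moreover have "Q X (tgt i) i" if "t X i = -1" using that \<open>i \<in> X\<close> \<open>i \<in> arcs \<Gamma>\<close> by (simp add: Q_def)
      ultimately show ?thesis using Qs Qt t[of X i] \<open>X \<in> \<A>\<close> unfolding c_def by auto
    qed
    have "2 ^ C < card (\<A> \<rightarrow>\<^sub>E {1, -1::int})"
    proof (rule proper_colouring_card[OF \<Gamma>(1) ind])
      fix u v assume "{u, v} \<in> gedges \<Gamma>"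
      from arc_exists[OF \<Gamma>(1) this] obtain i where
        i: "i \<in> arcs \<Gamma>" "src i = u \<and> tgt i = v \<or> src i = v \<and> tgt i = u" by blast
      have "c (src i) (p i) = t (p i) i" "c (tgt i) (p i) = - t (p i) i" using c p i(1) by blast+
      then have "c (src i) (p i) \<noteq> c (tgt i) (p i)" using t[of "p i" i] by auto
      then show "c u \<noteq> c v" using i(2) by auto
    next
      show "finite (\<A> \<rightarrow>\<^sub>E {1, -1::int})" using A by (intro finite_PiE) auto
      show "c ` gverts \<Gamma> \<subseteq> \<A> \<rightarrow>\<^sub>E {1, -1}"
        unfolding c_def by (intro image_subsetI restrict_PiE_iff[THEN iffD2] ballI) simp
    qed
    also have "\<dots> = 2 ^ card \<A>" using A by (simp add: card_PiE numeral_2_eq_2)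
    also have "\<dots> \<le> 2 ^ C" using A(2) by (intro power_increasing) auto
    finally show False by simp
  qed
qed

text \<open>Two of three arcs that meet a given arc do so at the same end, and therefore meet each other.\<close>

lemma line_sgraph_claw_free:
  assumes "{i, j} \<in> gedges (line_sgraph \<Gamma>)" "{i, k} \<in> gedges (line_sgraph \<Gamma>)" "{i, l} \<in> gedges (line_sgraph \<Gamma>)"
    and "j \<noteq> k" "k \<noteq> l" "j \<noteq> l"
  shows "{j, k} \<in> gedges (line_sgraph \<Gamma>) \<or> {k, l} \<in> gedges (line_sgraph \<Gamma>) \<or> {j, l} \<in> gedges (line_sgraph \<Gamma>)"
  using assms unfolding line_sgraph_edge_iff touching_def by metis

text \<open>As \<open>\<Gamma>\<close> has no triangle, the three arcs share a vertex; there the sign of each incidence occurs twice in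
  the product.\<close>

lemma line_sgraph_triangle_sign:
  assumes "triangle_free \<Gamma>"
    and "{i, j} \<in> gedges (line_sgraph \<Gamma>)" "{j, k} \<in> gedges (line_sgraph \<Gamma>)" "{i, k} \<in> gedges (line_sgraph \<Gamma>)"
  shows "gsign (line_sgraph \<Gamma>) {i, j} * gsign (line_sgraph \<Gamma>) {j, k} * gsign (line_sgraph \<Gamma>) {i, k} = 1"
proof -
  have arcs: "src x < tgt x \<and> {src x, tgt x} \<in> gedges \<Gamma>" if "x \<in> {i, j, k}" for x
    using assms that by (auto simp: line_sgraph_edge_iff arcs_def)
  have ne: "src x \<noteq> src y \<or> tgt x \<noteq> tgt y" if "x \<in> {i, j, k}" "y \<in> {i, j, k}" "x \<noteq> y" for x y
    using that arc_eqI by blast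
  have tri: False if "{a, b} \<in> gedges \<Gamma>" "{b, c} \<in> gedges \<Gamma>" "{a, c} \<in> gedges \<Gamma>" for a b c
    using assms(1) that unfolding triangle_free_def by blast
  have touch: "touching i j" "touching j k" "touching i k" and neq: "i \<noteq> j" "j \<noteq> k" "i \<noteq> k"
    using assms by (auto simp: line_sgraph_edge_iff)
  have "even (of_bool (consecutive i j) + of_bool (consecutive j k) + of_bool (consecutive i k) :: nat)"
    using touch ne[of i j] ne[of j k] ne[of i k] neq arcs[of i] arcs[of j] arcs[of k] tri
    unfolding touching_def consecutive_def
    by (smt (verit, ccfv_threshold) One_nat_def add.right_neutral add_0 even_plus_one_iff even_zero
      insert_iff insert_commute less_irrefl less_trans of_bool_eq(1) of_bool_eq(2) one_add_one even_numeral)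
  then show ?thesis
    using line_sgraph_sign[OF assms(2)] line_sgraph_sign[OF assms(3)] line_sgraph_sign[OF assms(4)]
    by (auto split: if_splits)
qed

section \<open>Forests of maximum degree two\<close>

text \<open>A longest path in a component has no neighbours outside: at its ends it could be extended, and an inner
  vertex would have degree three. So it passes through the whole component, and it has no chords because
  these would close cycles.\<close>

lemma linear_forestI:
  assumes "is_forest G"
    and deg: "\<And>x a b c. {x, a} \<in> gedges G \<Longrightarrow> {x, b} \<in> gedges G \<Longrightarrow> {x, c} \<in> gedges G \<Longrightarrow>
      a = b \<or> b = c \<or> a = c"
  shows "linear_forest G"
  unfolding linear_forest_def
proof (intro conjI ballI assms(1))
  let ?E = "gedges G" and ?R = "{(x, y). {x, y} \<in> gedges G}"
  have G: "simple_graph G" and acyclic: "\<And>vs. \<not> is_cycle G vs"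
    using assms(1) by (auto simp: is_forest_def)
  fix C assume "C \<in> component_sets G"
  then obtain v where v: "v \<in> gverts G" and C: "C = {u. (v, u) \<in> ?R\<^sup>*}"
    unfolding component_sets_def by blast
  have "u \<in> gverts G" if "(v, u) \<in> ?R\<^sup>*" for u
    using that by (induction rule: rtrancl_induct) (use v simple_graph_edgeD[OF G] in auto)
  then have "finite C" using G finite_subset[of C "gverts G"] by (auto simp: C simple_graph_def)
  have closed: "y \<in> C" if "x \<in> C" "{x, y} \<in> ?E" for x y
    using that unfolding C by (auto intro: rtrancl_into_rtrancl)
  have symR: "(x, y) \<in> ?R\<^sup>*" if "(y, x) \<in> ?R\<^sup>*" for x y
  proof -
    have "sym (?R\<^sup>*)" by (intro sym_rtrancl) (auto simp: sym_def insert_commute)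
    then show ?thesis using that by (auto simp: sym_def)
  qed
  define path where "path ps \<longleftrightarrow> ps \<noteq> [] \<and> distinct ps \<and> set ps \<subseteq> C \<and> successively (\<lambda>a b. {a, b} \<in> ?E) ps" for ps
  have "path [v]" by (simp add: path_def C)
  moreover have "length ps \<le> card C" if "path ps" for ps
    using that \<open>finite C\<close> by (metis path_def distinct_card card_mono)
  ultimately obtain ps where ps: "path ps" and max: "\<And>qs. path qs \<Longrightarrow> length qs \<le> length ps"
    using ex_has_greatest_nat[of path "[v]" length "Suc (card C)"] by (metis le_imp_less_Suc)
  have nbr: "w \<in> set ps" if "x \<in> set ps" "{x, w} \<in> ?E" for x w
  proof (rule ccontr)
    assume w: "w \<notin> set ps"
    have "w \<in> C" using closed that ps by (auto simp: path_def)
    from split_list[OF that(1)] obtain as bs where eq: "ps = as @ x # bs" by blast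
    consider "as = []" | "bs = []" | as' a b bs' where "as = as' @ [a]" "bs = b # bs'"
      by (metis list.exhaust rev_exhaust)
    then show False
    proof cases
      case 1
      then have "path (w # ps)" using ps w \<open>w \<in> C\<close> that(2) eq
        by (auto simp: path_def insert_commute)
      then show False using max by fastforce
    next
      case 2
      then have "path (ps @ [w])" using ps w \<open>w \<in> C\<close> that(2) eq
        by (auto simp: path_def successively_append_iff)
      then show False using max by fastforce
    next
      case 3
      then have "{x, a} \<in> ?E" "{x, b} \<in> ?E" "a \<noteq> b" "a \<noteq> w" "b \<noteq> w"
        using ps w eq by (auto simp: path_def successively_append_iff insert_commute)
      then show False using deg that(2) by blast
    qed
  qed
  have "u \<in> set ps" if "u \<in> C" for u
  proof -
    have "hd ps \<in> C" using ps by (auto simp: path_def)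
    then have "(hd ps, u) \<in> ?R\<^sup>*" using that symR unfolding C by (auto intro: rtrancl_trans)
    then show ?thesis
      by (induction rule: rtrancl_induct) (use ps nbr in \<open>auto simp: path_def\<close>)
  qed
  then have setps: "set ps = C" using ps by (auto simp: path_def)
  let ?n = "length ps"
  have consec: "{ps ! i, ps ! Suc i} \<in> ?E" if "Suc i < ?n" for i
    using ps that by (auto simp: path_def successively_conv_nth)
  have chord: "j = Suc i" if ij: "i < j" "j < ?n" "{ps ! i, ps ! j} \<in> ?E" for i j
  proof (rule ccontr)
    assume "j \<noteq> Suc i"
    let ?qs = "drop i (take (Suc j) ps)"
    have "is_cycle G ?qs"
    proof (rule is_cycle_path)
      show "distinct ?qs" using ps by (simp add: path_def)
      show "3 \<le> length ?qs" using ij \<open>j \<noteq> Suc i\<close> by simp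
      show "successively (\<lambda>a b. {a, b} \<in> gedges G) ?qs"
        using consec ij by (auto simp: successively_conv_nth)
      have "last ?qs = ps ! j" "hd ?qs = ps ! i"
        using ij by (auto simp: last_conv_nth hd_drop_conv_nth)
      then show "{last ?qs, hd ?qs} \<in> gedges G" using ij by (simp add: insert_commute)
    qed
    then show False using acyclic by blast
  qed
  have bij: "bij_betw ((!) ps) {..<?n} C"
    using ps setps by (intro bij_betw_nth) (auto simp: path_def)
  define f where "f = inv_into {..<?n} ((!) ps)"
  have f: "f (ps ! i) = i" if "i < ?n" for i
    using bij that by (auto simp: f_def bij_betw_def)
  have "gedges (path_graph ?n) = (\<lambda>e. f ` e) ` {e \<in> ?E. e \<subseteq> C}"
  proof (intro equalityI subsetI)
    fix e assume "e \<in> gedges (path_graph ?n)"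
    then obtain i where i: "e = {i, Suc i}" "Suc i < ?n" by (auto simp: path_graph_def)
    then have "e = f ` {ps ! i, ps ! Suc i}" using f by simp
    moreover have "{ps ! i, ps ! Suc i} \<subseteq> C" using i setps by (metis Suc_lessD empty_subsetI insert_subset nth_mem)
    ultimately show "e \<in> (\<lambda>e. f ` e) ` {e \<in> ?E. e \<subseteq> C}" using consec i by blast
  next
    fix e' assume "e' \<in> (\<lambda>e. f ` e) ` {e \<in> ?E. e \<subseteq> C}"
    then obtain e where e: "e' = f ` e" "e \<in> ?E" "e \<subseteq> C" by blast
    from simple_graph_edge[OF G e(2)] obtain x y where xy: "e = {x, y}" "x \<noteq> y" by metis
    then obtain i j where ij: "i < ?n" "j < ?n" "x = ps ! i" "y = ps ! j"
      using e(3) unfolding setps[symmetric] by (auto simp: in_set_conv_nth)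
    have "i \<noteq> j" using ij xy by auto
    then have "j = Suc i \<or> i = Suc j"
      using chord[of i j] chord[of j i] ij e(2) xy by (auto simp: insert_commute neq_iff)
    moreover have "e' = {i, j}" using e xy ij f by simp
    ultimately show "e' \<in> gedges (path_graph ?n)"
      using ij by (auto simp: path_graph_def insert_commute)
  qed
  moreover have "bij_betw f C {..<?n}" unfolding f_def using bij by (rule bij_betw_inv_into)
  ultimately have "graph_isomorphism f (induced_graph G C) (path_graph ?n)"
    by (simp add: graph_isomorphism_def induced_graph_def path_graph_def)
  moreover have "1 \<le> ?n" using ps by (cases ps) (auto simp: path_def)
  ultimately show "\<exists>n\<ge>1. graph_isomorphic (induced_graph G C) (path_graph n)"
    unfolding graph_isomorphic_def by blast
qed

section \<open>Members of a GS set of order two\<close>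

lemma three_elements:
  assumes "3 \<le> card S"
  obtains a b c where "a \<in> S" "b \<in> S" "c \<in> S" "a \<noteq> b" "b \<noteq> c" "a \<noteq> c"
proof -
  obtain T where "T \<subseteq> S" "card T = 3" using obtain_subset_with_card_n[OF assms] by metis
  then show ?thesis using that unfolding card_3_iff by blast
qed

lemma complete_iso:
  assumes "simple_graph G" "\<And>x y. x \<in> gverts G \<Longrightarrow> y \<in> gverts G \<Longrightarrow> x \<noteq> y \<Longrightarrow> {x, y} \<in> gedges G"
  obtains f where "bij_betw f (gverts G) (gverts (complete_graph (card (gverts G))))"
    "gedges (complete_graph (card (gverts G))) = (\<lambda>e. f ` e) ` gedges G"
proof -
  let ?n = "card (gverts G)"
  have "finite (gverts G)" using assms(1) by (simp add: simple_graph_def)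
  then obtain f where f: "bij_betw f (gverts G) {0..<?n}" using ex_bij_betw_finite_nat by blast
  have "gedges (complete_graph ?n) = (\<lambda>e. f ` e) ` gedges G"
  proof (intro equalityI subsetI)
    fix e assume "e \<in> gedges (complete_graph ?n)"
    then obtain i j where ij: "e = {i, j}" "i < ?n" "j < ?n" "i \<noteq> j" by (auto simp: complete_graph_def)
    moreover have "f ` gverts G = {0..<?n}" using f by (rule bij_betw_imp_surj_on)
    ultimately have "i \<in> f ` gverts G" "j \<in> f ` gverts G" by simp_all
    then obtain x y where xy: "x \<in> gverts G" "y \<in> gverts G" "i = f x" "j = f y" by blast
    then have "{x, y} \<in> gedges G" using assms(2) ij(4) by blast
    then have "f ` {x, y} \<in> (\<lambda>e. f ` e) ` gedges G" by blast
    then show "e \<in> (\<lambda>e. f ` e) ` gedges G" using ij(1) xy by simp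
  next
    fix e' assume "e' \<in> (\<lambda>e. f ` e) ` gedges G"
    then obtain e where e: "e' = f ` e" "e \<in> gedges G" by blast
    from simple_graph_edge[OF assms(1) e(2)] obtain x y
      where xy: "e = {x, y}" "x \<in> gverts G" "y \<in> gverts G" "x \<noteq> y" by metis
    then have "f x < ?n" "f y < ?n" "f x \<noteq> f y"
      using f by (auto simp: bij_betw_def inj_on_def)
    then show "e' \<in> gedges (complete_graph ?n)" using e xy by simp
  qed
  moreover have "bij_betw f (gverts G) (gverts (complete_graph ?n))"
    using f by (simp add: complete_graph_def atLeast0LessThan)
  ultimately show ?thesis using that by blast
qed

lemma complete_card_ge_3:
  assumes "simple_graph G" "\<And>x y. x \<in> gverts G \<Longrightarrow> y \<in> gverts G \<Longrightarrow> x \<noteq> y \<Longrightarrow> {x, y} \<in> gedges G"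
    and "\<not> graph_isomorphic G (complete_graph 1)" "\<not> graph_isomorphic G (complete_graph 2)"
  shows "3 \<le> card (gverts G)"
proof -
  from complete_iso[OF assms(1,2)] have "graph_isomorphic G (complete_graph (card (gverts G)))"
    unfolding graph_isomorphic_def graph_isomorphism_def by metis
  then have "card (gverts G) \<noteq> 1" "card (gverts G) \<noteq> 2" using assms(3,4) by metis+
  moreover have "card (gverts G) \<noteq> 0" using assms(1) by (auto simp: simple_graph_def)
  ultimately show ?thesis by linarith
qed

lemma GS_all_negative:
  assumes "GS_set {A, B}"
  shows "\<exists>\<Gamma> :: nat ugraph. simple_graph \<Gamma> \<and> (\<forall>vs. is_cycle \<Gamma> vs \<longrightarrow> g < length vs) \<and>
    ((\<exists>h t. embeds h t A (all_negative \<Gamma>)) \<or> (\<exists>h t. embeds h t B (all_negative \<Gamma>)))"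
proof -
  from GS_set_embeds[OF assms] obtain C where C: "\<And>G :: nat sgraph. signed_graph G \<Longrightarrow>
    balanced_chromatic_number G > C \<Longrightarrow> (\<exists>h t. embeds h t A G) \<or> (\<exists>h t. embeds h t B G)" by blast
  obtain \<Gamma> :: "nat ugraph" where \<Gamma>: "simple_graph \<Gamma>" "\<forall>vs. is_cycle \<Gamma> vs \<longrightarrow> g < length vs"
    and ind: "\<And>W. W \<subseteq> gverts \<Gamma> \<Longrightarrow> independent_in (gedges \<Gamma>) W \<Longrightarrow> (2 * C + 1) * card W < card (gverts \<Gamma>)"
    using large_girth_small_independence[of "2 * C + 1" g] by auto
  have ind': "2 * C * card W < card (gverts \<Gamma>)"
    if "W \<subseteq> gverts \<Gamma>" "independent_in (gedges \<Gamma>) W" for W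
    using ind[OF that] by simp
  have "C < balanced_chromatic_number (all_negative \<Gamma>)"
    using chi_b_negative_part[OF \<Gamma>(1) ind' signed_graph_all_negative[OF \<Gamma>(1)]] by simp
  then show ?thesis using C signed_graph_all_negative[OF \<Gamma>(1)] \<Gamma> by blast
qed

lemma GS_signed_complete:
  assumes "GS_set {A, B}"
  shows "\<exists>\<Gamma> :: nat ugraph. triangle_free \<Gamma> \<and>
    ((\<exists>h t. embeds h t A (signed_complete \<Gamma>)) \<or> (\<exists>h t. embeds h t B (signed_complete \<Gamma>)))"
proof -
  from GS_set_embeds[OF assms] obtain C where C: "\<And>G :: nat sgraph. signed_graph G \<Longrightarrow>
    balanced_chromatic_number G > C \<Longrightarrow> (\<exists>h t. embeds h t A G) \<or> (\<exists>h t. embeds h t B G)" by blast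
  obtain \<Gamma> :: "nat ugraph" where \<Gamma>: "simple_graph \<Gamma>" "\<forall>vs. is_cycle \<Gamma> vs \<longrightarrow> 3 < length vs"
    and ind: "\<And>W. W \<subseteq> gverts \<Gamma> \<Longrightarrow> independent_in (gedges \<Gamma>) W \<Longrightarrow> (2 * C + 1) * card W < card (gverts \<Gamma>)"
    using large_girth_small_independence[of "2 * C + 1" 3] by auto
  have ind': "2 * C * card W < card (gverts \<Gamma>)"
    if "W \<subseteq> gverts \<Gamma>" "independent_in (gedges \<Gamma>) W" for W
    using ind[OF that] by simp
  have S: "signed_graph (signed_complete \<Gamma>)"
    unfolding signed_complete_def using \<Gamma>(1) by (intro signed_graph_sgraph_of) (auto simp: simple_graph_def)
  have sub: "e \<in> gedges (signed_complete \<Gamma>) \<and> gsign (signed_complete \<Gamma>) e = -1" if "e \<in> gedges \<Gamma>" for e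
  proof -
    from simple_graph_edge[OF \<Gamma>(1) that] obtain u v
      where uv: "e = {u, v}" "u \<in> gverts \<Gamma>" "v \<in> gverts \<Gamma>" "u \<noteq> v" by metis
    then have "{u, v} \<in> gedges (signed_complete \<Gamma>)" by (simp add: signed_complete_edge_iff)
    from this signed_complete_sign[OF this] show ?thesis using that unfolding uv(1) by simp
  qed
  have "C < balanced_chromatic_number (signed_complete \<Gamma>)"
    by (rule chi_b_negative_part[OF \<Gamma>(1) ind' S]) (use sub in auto)
  then show ?thesis using C S triangle_freeI[OF \<Gamma>(1)] \<Gamma>(2) by blast
qed

lemma GS_line_sgraph:
  assumes "GS_set {A, B}"
  shows "\<exists>\<Gamma> :: nat ugraph. triangle_free \<Gamma> \<and>
    ((\<exists>h t. embeds h t A (line_sgraph \<Gamma>)) \<or> (\<exists>h t. embeds h t B (line_sgraph \<Gamma>)))"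
proof -
  from GS_set_embeds[OF assms] obtain C where C: "\<And>G :: nat sgraph. signed_graph G \<Longrightarrow>
    balanced_chromatic_number G > C \<Longrightarrow> (\<exists>h t. embeds h t A G) \<or> (\<exists>h t. embeds h t B G)" by blast
  obtain \<Gamma> :: "nat ugraph" where \<Gamma>: "simple_graph \<Gamma>" "\<forall>vs. is_cycle \<Gamma> vs \<longrightarrow> 3 < length vs"
    and ind: "\<And>W. W \<subseteq> gverts \<Gamma> \<Longrightarrow> independent_in (gedges \<Gamma>) W \<Longrightarrow> 2 ^ C * card W < card (gverts \<Gamma>)"
    using large_girth_small_independence[of "2 ^ C" 3] by auto
  have "gedges \<Gamma> \<noteq> {}"
  proof
    assume "gedges \<Gamma> = {}"
    then have "2 ^ C * card (gverts \<Gamma>) < card (gverts \<Gamma>)"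
      by (intro ind) (auto simp: independent_in_def)
    moreover have "1 * card (gverts \<Gamma>) \<le> 2 ^ C * card (gverts \<Gamma>)" by (intro mult_right_mono) auto
    ultimately show False by linarith
  qed
  from chi_b_line_sgraph[OF \<Gamma>(1) this ind] show ?thesis
    using C triangle_freeI[OF \<Gamma>(1)] \<Gamma>(2) by blast
qed

text \<open>Each conclusion is reached by excluding one member from one of the three families above, which forces the
  other member into it. For the bound on the order of \<open>A\<close>, the product \<open>r\<close> of the two switchings
  of \<open>A\<close> that come from \<open>(K\<^sub>n, -)\<close> and from the signed complete graph of \<open>\<Gamma>\<close> decides adjacency:
  vertices with the same value of \<open>r\<close> are adjacent in \<open>\<Gamma>\<close>. In the line graph, \<open>A\<close> is excluded because the sign of a triangle does not change under switching.\<close>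

lemma GS_dichotomy:
  fixes A B :: "'a sgraph"
  assumes GS: "GS_set {A, B}"
    and A_nontriv: "\<not> graph_isomorphic A (complete_graph 1)" "\<not> graph_isomorphic A (complete_graph 2)"
    and B_nontriv: "\<not> graph_isomorphic B (complete_graph 1)" "\<not> graph_isomorphic B (complete_graph 2)"
    and emb: "embeds h t A (all_negative (complete_graph n))"
  shows "(switching_equivalent A (all_negative (complete_graph 3)) \<or>
      switching_equivalent A (all_negative (complete_graph 4))) \<and> linear_forest B"
proof -
  let ?m = "card (gverts A)"
  have A: "simple_graph A" and B: "simple_graph B"
    using GS by (auto simp: GS_set_def signed_graph_def)
  have t: "t x \<in> {1, -1}" for x using emb by (simp add: embeds_def)
  have A_edge: "{x, y} \<in> gedges A" if "x \<in> gverts A" "y \<in> gverts A" "x \<noteq> y" for x y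
  proof -
    have "h x \<noteq> h y" "h x < n" "h y < n"
      using that emb by (auto simp: embeds_def inj_on_def complete_graph_def)
    then show ?thesis using that emb by (simp add: embeds_def)
  qed
  have A_sign: "gsign A {x, y} = - (t x * t y)" if "{x, y} \<in> gedges A" for x y
  proof -
    have "{h x, h y} \<in> gedges (complete_graph n)"
      using that emb simple_graph_edgeD[OF A that] unfolding embeds_def by auto
    then show ?thesis using that emb by (simp add: embeds_def)
  qed
  have m3: "3 \<le> ?m" using complete_card_ge_3[OF A A_edge A_nontriv] .
  then obtain x y z where xyz: "x \<in> gverts A" "y \<in> gverts A" "z \<in> gverts A" "x \<noteq> y" "y \<noteq> z" "x \<noteq> z"
    by (rule three_elements)
  note A_tri = A_edge[OF xyz(1,2,4)] A_edge[OF xyz(2,3,5)] A_edge[OF xyz(1,3,6)]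
  have forest: "is_forest B"
    unfolding is_forest_def
  proof (intro conjI B notI)
    assume "\<exists>vs. is_cycle B vs"
    then obtain vs where vs: "is_cycle B vs" by blast
    from GS_all_negative[OF GS, of "max 3 (length vs)"] obtain \<Gamma> :: "nat ugraph" where \<Gamma>: "simple_graph \<Gamma>"
      "\<And>ws. is_cycle \<Gamma> ws \<Longrightarrow> max 3 (length vs) < length ws"
      and emb': "(\<exists>h t. embeds h t A (all_negative \<Gamma>)) \<or> (\<exists>h t. embeds h t B (all_negative \<Gamma>))" by blast
    have cyc: "is_cycle (all_negative \<Gamma>) ws \<longleftrightarrow> is_cycle \<Gamma> ws" for ws by (simp add: is_cycle_def)
    from emb' show False
    proof (elim disjE exE)
      fix h t assume "embeds h t A (all_negative \<Gamma>)"
      from embeds_cycle[OF this A triangle_cycle[OF A A_tri]] show False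
        using \<Gamma>(2)[of "map h [x, y, z]"] unfolding cyc by simp
    next
      fix h t assume "embeds h t B (all_negative \<Gamma>)"
      from embeds_cycle[OF this B vs] show False
        using \<Gamma>(2)[of "map h vs"] unfolding cyc by simp
    qed
  qed
  then have no_tri: "\<not> ({a, b} \<in> gedges B \<and> {b, c} \<in> gedges B \<and> {a, c} \<in> gedges B)" for a b c
    using triangle_cycle[OF B] unfolding is_forest_def by blast
  have "linear_forest B"
  proof (rule linear_forestI[OF forest], rule ccontr)
    fix v a b c
    assume claw: "{v, a} \<in> gedges B" "{v, b} \<in> gedges B" "{v, c} \<in> gedges B"
      and neq: "\<not> (a = b \<or> b = c \<or> a = c)"
    from GS_line_sgraph[OF GS] obtain \<Gamma> :: "nat ugraph" where \<Gamma>: "triangle_free \<Gamma>"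
      and emb': "(\<exists>h t. embeds h t A (line_sgraph \<Gamma>)) \<or> (\<exists>h t. embeds h t B (line_sgraph \<Gamma>))" by blast
    let ?L = "line_sgraph \<Gamma>"
    from emb' show False
    proof (elim disjE exE)
      fix h' t' assume e: "embeds h' t' A ?L"
      have t': "t' x \<in> {1, -1}" for x using e by (simp add: embeds_def)
      have "{h' x, h' y} \<in> gedges ?L" "{h' y, h' z} \<in> gedges ?L" "{h' x, h' z} \<in> gedges ?L"
        using e A_tri xyz by (auto simp: embeds_def)
      from line_sgraph_triangle_sign[OF \<Gamma> this]
      have tri: "gsign ?L {h' x, h' y} * gsign ?L {h' y, h' z} * gsign ?L {h' x, h' z} = 1" .
      have sgn: "- (t x * t y) = t' x * t' y * gsign ?L {h' x, h' y}"
        "- (t y * t z) = t' y * t' z * gsign ?L {h' y, h' z}"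
        "- (t x * t z) = t' x * t' z * gsign ?L {h' x, h' z}"
        using e A_tri A_sign by (metis embeds_def)+
      have "- ((t x * t x) * (t y * t y) * (t z * t z)) =
        (- (t x * t y)) * (- (t y * t z)) * (- (t x * t z))" by (simp add: algebra_simps)
      also have "\<dots> = (t' x * t' x) * (t' y * t' y) * (t' z * t' z) *
        (gsign ?L {h' x, h' y} * gsign ?L {h' y, h' z} * gsign ?L {h' x, h' z})"
        unfolding sgn by (simp only: mult_ac)
      finally show False unfolding tri sign_square[OF t] sign_square[OF t'] by simp
    next
      fix h' t' assume e: "embeds h' t' B ?L"
      note verts = simple_graph_edgeD[OF B claw(1)] simple_graph_edgeD[OF B claw(2)] simple_graph_edgeD[OF B claw(3)]
      have edge: "{h' p, h' q} \<in> gedges ?L \<longleftrightarrow> {p, q} \<in> gedges B" if "p \<in> gverts B" "q \<in> gverts B" for p q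
        using e that by (simp add: embeds_def)
      have inj: "h' p \<noteq> h' q" if "p \<in> gverts B" "q \<in> gverts B" "p \<noteq> q" for p q
        using e that by (auto simp: embeds_def inj_on_def)
      have "{h' a, h' b} \<in> gedges ?L \<or> {h' b, h' c} \<in> gedges ?L \<or> {h' a, h' c} \<in> gedges ?L"
        using claw neq verts by (intro line_sgraph_claw_free[of "h' v"]) (simp_all add: edge inj)
      then have "{a, b} \<in> gedges B \<or> {b, c} \<in> gedges B \<or> {a, c} \<in> gedges B"
        using verts by (simp add: edge)
      then show False using no_tri[of v a b] no_tri[of v b c] no_tri[of v a c] claw by blast
    qed
  qed
  moreover have "?m \<le> 4"
  proof -
    from GS_signed_complete[OF GS] obtain \<Gamma> :: "nat ugraph" where \<Gamma>: "triangle_free \<Gamma>"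
      and emb': "(\<exists>h t. embeds h t A (signed_complete \<Gamma>)) \<or> (\<exists>h t. embeds h t B (signed_complete \<Gamma>))"
      by blast
    let ?S = "signed_complete \<Gamma>"
    have edge: "{h' p, h' q} \<in> gedges ?S" if "embeds h' t' H ?S" "p \<in> gverts H" "q \<in> gverts H" "p \<noteq> q"
      for h' t' p q and H :: "'a sgraph"
      using that by (auto simp: embeds_def inj_on_def signed_complete_edge_iff)
    from emb' show ?thesis
    proof (elim disjE exE)
      fix h' t' assume e: "embeds h' t' B ?S"
      have "{p, q} \<in> gedges B" if "p \<in> gverts B" "q \<in> gverts B" "p \<noteq> q" for p q
        using edge[OF e that] e that by (simp add: embeds_def)
      then have "3 \<le> card (gverts B)" and "\<And>p q. p \<in> gverts B \<Longrightarrow> q \<in> gverts B \<Longrightarrow> p \<noteq> q \<Longrightarrow> {p, q} \<in> gedges B"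
        using complete_card_ge_3[OF B _ B_nontriv] by blast+
      then show ?thesis using no_tri by (metis three_elements)
    next
      fix h' t' assume e: "embeds h' t' A ?S"
      have t': "t' x \<in> {1, -1}" for x using e by (simp add: embeds_def)
      define r where "r x = t x * t' x" for x
      have r: "r x \<in> {1, -1}" for x using t[of x] t'[of x] by (auto simp: r_def)
      have neg: "{h' p, h' q} \<in> gedges \<Gamma>" if "p \<in> gverts A" "q \<in> gverts A" "p \<noteq> q" "r p = r q" for p q
      proof -
        have "- (t p * t q) = t' p * t' q * gsign ?S {h' p, h' q}"
          using e A_edge[OF that(1-3)] A_sign[OF A_edge[OF that(1-3)]] by (simp add: embeds_def)
        then have "gsign ?S {h' p, h' q} = - (r p * r q)"
          using t'[of p] t'[of q] by (auto simp: r_def)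
        also have "\<dots> = -1" using that(4) r[of q] by auto
        finally show ?thesis
          using signed_complete_sign[OF edge[OF e that(1-3)]] by (auto split: if_splits)
      qed
      have "card {p \<in> gverts A. r p = s} \<le> 2" for s
      proof (rule ccontr)
        assume "\<not> ?thesis"
        then have "3 \<le> card {p \<in> gverts A. r p = s}" by simp
        then obtain a b c where "a \<in> {p \<in> gverts A. r p = s}" "b \<in> {p \<in> gverts A. r p = s}"
          "c \<in> {p \<in> gverts A. r p = s}" "a \<noteq> b" "b \<noteq> c" "a \<noteq> c" by (rule three_elements)
        then have "{h' a, h' b} \<in> gedges \<Gamma>" "{h' b, h' c} \<in> gedges \<Gamma>" "{h' a, h' c} \<in> gedges \<Gamma>"
          using neg by auto
        then show False using \<Gamma> by (auto simp: triangle_free_def)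
      qed
      note two = this
      have "gverts A = {p \<in> gverts A. r p = 1} \<union> {p \<in> gverts A. r p = -1}" using r by auto
      then have "?m \<le> card {p \<in> gverts A. r p = 1} + card {p \<in> gverts A. r p = -1}"
        using card_Un_le[of "{p \<in> gverts A. r p = 1}" "{p \<in> gverts A. r p = -1}"] by simp
      then show ?thesis using two[of 1] two[of "-1"] by linarith
    qed
  qed
  moreover have "switching_equivalent A (all_negative (complete_graph ?m))"
  proof -
    from complete_iso[OF A A_edge] obtain f where
      f: "bij_betw f (gverts A) (gverts (complete_graph ?m))"
        "gedges (complete_graph ?m) = (\<lambda>e. f ` e) ` gedges A" by metis
    show ?thesis
    proof (rule switching_equivalentI[OF A])
      fix u v assume uv: "{u, v} \<in> gedges A"
      have "f ` {u, v} \<in> gedges (complete_graph ?m)" unfolding f(2) using uv by blast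
      then have "{f u, f v} \<in> gedges (complete_graph ?m)" by (simp del: complete_graph_edge_iff)
      then show "gsign (all_negative (complete_graph ?m)) {f u, f v} = t u * t v * gsign A {u, v}"
        using A_sign[OF uv] t[of u] t[of v] by (auto simp del: complete_graph_edge_iff)
    qed (use f t in auto)
  qed
  moreover have "?m = 3 \<or> ?m = 4" using m3 \<open>?m \<le> 4\<close> by linarith
  ultimately show ?thesis by auto
qed

theorem mainTheorem1:
  fixes \<F> :: "'a sgraph set" and F1 F2 :: "'a sgraph"
  assumes "\<F> = {F1, F2}"
    and "card \<F> = 2"
    and "GS_set \<F>"
    and "\<forall>H \<in> \<F>. \<not> graph_isomorphic H (complete_graph 1) \<and>
                  \<not> graph_isomorphic H (complete_graph 2)"
  shows "((switching_equivalent F1 (all_negative (complete_graph 3)) \<or>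
           switching_equivalent F1 (all_negative (complete_graph 4))) \<and> linear_forest F2) \<or>
         ((switching_equivalent F2 (all_negative (complete_graph 3)) \<or>
           switching_equivalent F2 (all_negative (complete_graph 4))) \<and> linear_forest F1)"
proof -
  have GS: "GS_set {F1, F2}" "GS_set {F2, F1}" using assms(1,3) by (simp_all add: insert_commute)
  from GS_set_embeds[OF GS(1)] obtain C where C: "\<And>G :: nat sgraph. signed_graph G \<Longrightarrow>
    balanced_chromatic_number G > C \<Longrightarrow> (\<exists>h t. embeds h t F1 G) \<or> (\<exists>h t. embeds h t F2 G)" by blast
  let ?K = "all_negative (complete_graph (2 * C + 1))"
  have "signed_graph ?K" by (intro signed_graph_all_negative simple_graph_complete) simp
  from C[OF this chi_b_complete] have "(\<exists>h t. embeds h t F1 ?K) \<or> (\<exists>h t. embeds h t F2 ?K)" by simp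
  then show ?thesis
    using GS_dichotomy[OF GS(1)] GS_dichotomy[OF GS(2)] assms(1,4) by blast
qed

end
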